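(* For every $1<p<2$ there is a constant $C_p$ such that for all sufficiently large $d$ there exist quantum channels $\mathcal N_1,\mathcal N_2$, each with output dimension $d$, satisfying $$H_p^{\min}(\mathcal N_1)\ge \ln d-2,\qquad H_p^{\min}(\mathcal N_2)\ge \ln d-2,\qquad H_p^{\min}(\mathcal N_1\otimes\mathcal N_2)\le p\ln d + C_p .$$ Consequently $H_p^{\min}(\mathcal N_1)+H_p^{\min}(\mathcal N_2)-H_p^{\min}(\mathcal N_1\otimes\mathcal N_2)\ge (2-p)\ln d - C_p-4>0$ for large $d$, so additivity of the minimum output Rényi entropy of order $p$ fails, and equivalently the maximal $p$-norm is not multiplicative: $\nu_p(\mathcal N_1\otimes\mathcal N_2)>\nu_p(\mathcal N_1)\nu_p(\mathcal N_2)$.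
   Context: A quantum channel is a completely positive trace-preserving linear map between matrix algebras of finite-dimensional Hilbert spaces. For a density operator $\rho$ and $p>0$, $p\ne1$, $H_p(\rho)=\frac{1}{1-p}\ln\operatorname{Tr}\rho^p$. For a channel $\mathcal N$, $H_p^{\min}(\mathcal N)=\min_{|\varphi\rangle}H_p(\mathcal N(|\varphi\rangle\langle\varphi|))$, the minimum over unit input vectors. The maximal $p$-norm is $\nu_p(\mathcal N)=\sup\{\|\mathcal N(\rho)\|_p:\rho\ge0,\operatorname{Tr}\rho=1\}$ with $\|\sigma\|_p=(\operatorname{Tr}|\sigma|^p)^{1/p}$; one has $H_p^{\min}(\mathcal N)=\frac{p}{1-p}\ln\nu_p(\mathcal N)$. *)

theory Defs
  imports "Jordan_Normal_Form.Char_Poly" "HOL-Library.Multiset"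
begin

text \<open>Complex matrices are Jordan_Normal_Form matrices of type complex mat.
  The space M_n is carrier_mat n n.  Composite index convention for
  tensor products: C^a (x) C^b, pair (i,j) corresponds to index i*b+j.\<close>

definition mat_trace :: "complex mat \<Rightarrow> complex" where
  "mat_trace A = (\<Sum>i<dim_row A. A $$ (i,i))"

definition hermitian_mat :: "nat \<Rightarrow> complex mat \<Rightarrow> bool" where
  "hermitian_mat n A \<longleftrightarrow> A \<in> carrier_mat n n \<and>
     (\<forall>i<n. \<forall>j<n. A $$ (j,i) = cnj (A $$ (i,j)))"

definition psd_mat :: "nat \<Rightarrow> complex mat \<Rightarrow> bool" where
  "psd_mat n A \<longleftrightarrow> hermitian_mat n A \<and>
     (\<forall>v \<in> carrier_vec n.
        0 \<le> Re (\<Sum>i<n. \<Sum>j<n. cnj (v $ i) * A $$ (i,j) * v $ j))"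

definition density_op :: "nat \<Rightarrow> complex mat \<Rightarrow> bool" where
  "density_op n \<rho> \<longleftrightarrow> psd_mat n \<rho> \<and> mat_trace \<rho> = 1"

definition lin_map :: "nat \<Rightarrow> nat \<Rightarrow> (complex mat \<Rightarrow> complex mat) \<Rightarrow> bool" where
  "lin_map n d \<Phi> \<longleftrightarrow>
     (\<forall>A \<in> carrier_mat n n. \<Phi> A \<in> carrier_mat d d) \<and>
     (\<forall>A \<in> carrier_mat n n. \<forall>B \<in> carrier_mat n n. \<Phi> (A + B) = \<Phi> A + \<Phi> B) \<and>
     (\<forall>A \<in> carrier_mat n n. \<forall>c. \<Phi> (c \<cdot>\<^sub>m A) = c \<cdot>\<^sub>m \<Phi> A)"

text \<open>The ampliation id_{M_k} (x) Phi, acting on M_k (x) M_n = M_{k n}: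
  it applies Phi to each n x n block.\<close>
definition ampliation :: "nat \<Rightarrow> nat \<Rightarrow> nat \<Rightarrow> (complex mat \<Rightarrow> complex mat)
    \<Rightarrow> complex mat \<Rightarrow> complex mat" where
  "ampliation k n d \<Phi> X = mat (k*d) (k*d) (\<lambda>(i,j).
      \<Phi> (mat n n (\<lambda>(u,w). X $$ ((i div d)*n + u, (j div d)*n + w))) $$ (i mod d, j mod d))"

definition completely_positive :: "nat \<Rightarrow> nat \<Rightarrow> (complex mat \<Rightarrow> complex mat) \<Rightarrow> bool" where
  "completely_positive n d \<Phi> \<longleftrightarrow>
     (\<forall>k. \<forall>X. psd_mat (k*n) X \<longrightarrow> psd_mat (k*d) (ampliation k n d \<Phi> X))"

definition trace_preserving :: "nat \<Rightarrow> (complex mat \<Rightarrow> complex mat) \<Rightarrow> bool" where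
  "trace_preserving n \<Phi> \<longleftrightarrow> (\<forall>A \<in> carrier_mat n n. mat_trace (\<Phi> A) = mat_trace A)"

definition quantum_channel :: "nat \<Rightarrow> nat \<Rightarrow> (complex mat \<Rightarrow> complex mat) \<Rightarrow> bool" where
  "quantum_channel n d \<Phi> \<longleftrightarrow> 0 < n \<and> 0 < d \<and> lin_map n d \<Phi> \<and>
     completely_positive n d \<Phi> \<and> trace_preserving n \<Phi>"

definition mat_unit :: "nat \<Rightarrow> nat \<Rightarrow> nat \<Rightarrow> complex mat" where
  "mat_unit n a b = mat n n (\<lambda>(i,j). if i = a \<and> j = b then 1 else 0)"

text \<open>Tensor product of channels N1 : M_n1 -> M_d1, N2 : M_n2 -> M_d2, the unique
  linear map with (N1 (x) N2)(A (x) B) = N1 A (x) N2 B, written out in matrix units.\<close>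
definition tensor_channel :: "nat \<Rightarrow> nat \<Rightarrow> nat \<Rightarrow> nat \<Rightarrow>
    (complex mat \<Rightarrow> complex mat) \<Rightarrow> (complex mat \<Rightarrow> complex mat) \<Rightarrow> complex mat \<Rightarrow> complex mat" where
  "tensor_channel n1 d1 n2 d2 N1 N2 X = mat (d1*d2) (d1*d2) (\<lambda>(i,j).
      \<Sum>a<n1. \<Sum>b<n1. \<Sum>c<n2. \<Sum>e<n2.
        X $$ (a*n2 + c, b*n2 + e) * N1 (mat_unit n1 a b) $$ (i div d2, j div d2)
          * N2 (mat_unit n2 c e) $$ (i mod d2, j mod d2))"

definition eigenvalue_mset :: "complex mat \<Rightarrow> complex multiset" where
  "eigenvalue_mset A = (SOME M. char_poly A = prod_mset (image_mset (\<lambda>a. [:- a, 1:]) M))"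

text \<open>Tr rho^p for a positive semidefinite rho (eigenvalues are nonnegative reals).\<close>
definition trace_power :: "complex mat \<Rightarrow> real \<Rightarrow> real" where
  "trace_power \<rho> p = sum_mset (image_mset (\<lambda>x. Re x powr p) (eigenvalue_mset \<rho>))"

definition renyi_entropy :: "real \<Rightarrow> complex mat \<Rightarrow> real" where
  "renyi_entropy p \<rho> = ln (trace_power \<rho> p) / (1 - p)"

definition unit_vecs :: "nat \<Rightarrow> complex vec set" where
  "unit_vecs n = {v \<in> carrier_vec n. (\<Sum>i<n. (cmod (v $ i))\<^sup>2) = 1}"

definition pure_state :: "nat \<Rightarrow> complex vec \<Rightarrow> complex mat" where
  "pure_state n v = mat n n (\<lambda>(i,j). v $ i * cnj (v $ j))"

definition min_output_renyi :: "real \<Rightarrow> nat \<Rightarrow> (complex mat \<Rightarrow> complex mat) \<Rightarrow> real" where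
  "min_output_renyi p n N = (INF v \<in> unit_vecs n. renyi_entropy p (N (pure_state n v)))"

definition schatten_norm_psd :: "real \<Rightarrow> complex mat \<Rightarrow> real" where
  "schatten_norm_psd p \<sigma> = trace_power \<sigma> p powr (1 / p)"

definition max_output_pnorm :: "real \<Rightarrow> nat \<Rightarrow> (complex mat \<Rightarrow> complex mat) \<Rightarrow> real" where
  "max_output_pnorm p n N = (SUP \<rho> \<in> {\<rho>. density_op n \<rho>}. schatten_norm_psd p (N \<rho>))"

end

theory Submission
  imports Defs "Jordan_Normal_Form.Schur_Decomposition" "HOL-Probability.Distributions"
    "HOL-Real_Asymp.Real_Asymp"
begin

text \<open>Take \<open>N2\<close> to be the complex conjugate of \<open>N1\<close>. For any channel with \<open>e\<close> Kraus operators from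
  dimension \<open>n\<close> to dimension \<open>d\<close>, the maximally entangled input gives an output of \<open>N1 \<otimes> N2\<close> whose
  overlap with the maximally entangled state is at least \<open>n / (d e)\<close>, hence an eigenvalue that large.
  We let \<open>e = d\<^sup>2\<close> and \<open>n\<close> of order \<open>e d powr (2 - p)\<close>, so this eigenvalue is of order \<open>d powr (1 - p)\<close>.

  It remains to find such a channel all of whose outputs are nearly maximally mixed. Fix one \<open>k\<close> of
  order \<open>d powr s\<close> with \<open>2 - p < s < 1 / p\<close>. If no output puts mass more than \<open>6 k / d\<close> on a
  \<open>k\<close>-dimensional subspace, then fewer than \<open>k\<close> eigenvalues exceed \<open>6 / d\<close>, and
  \<open>Tr \<sigma>\<^sup>p \<le> (6 / d) powr (p - 1) + (6 k / d) powr p\<close>, whose second term is negligible because \<open>s < 1 / p\<close>.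
  The channel comes from the column space of a random sign matrix with \<open>d e\<close> rows and \<open>n\<close> columns:
  for a fixed input and a fixed \<open>k\<close>-frame, the mass on the frame has an exponential moment of at most
  \<open>2 ^ (k e)\<close>. Since \<open>s > 2 - p\<close>, \<open>n ln d\<close> is negligible against \<open>k e\<close>, so a union bound over a crude
  grid of inputs and frames is affordable. Diagonalising the Gram matrix turns the columns into an
  isometry, once the eigenvectors with small eigenvalue (at most \<open>5 / 6\<close> of them) are discarded.\<close>

hide_const (open) Finite_Cartesian_Product.mat Finite_Cartesian_Product.vec
hide_type (open) Finite_Cartesian_Product.vec
unbundle no vec_syntax

section \<open>The spectral theorem\<close>

definition adj :: "complex mat \<Rightarrow> complex mat" where
  "adj A = mat (dim_col A) (dim_row A) (\<lambda>(i,j). cnj (A $$ (j,i)))"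

lemma adj_carrier [simp]: "A \<in> carrier_mat n m \<Longrightarrow> adj A \<in> carrier_mat m n"
  by (auto simp: adj_def)

lemma adj_dim [simp]: "dim_row (adj A) = dim_col A" "dim_col (adj A) = dim_row A"
  by (auto simp: adj_def)

lemma adj_index [simp]: "A \<in> carrier_mat n m \<Longrightarrow> i < m \<Longrightarrow> j < n \<Longrightarrow> adj A $$ (i,j) = cnj (A $$ (j,i))"
  by (auto simp: adj_def)

lemma adj_adj [simp]: "adj (adj A) = A"
  by (rule eq_matI) (auto simp: adj_def)

lemma adj_mult:
  assumes "A \<in> carrier_mat n m" "B \<in> carrier_mat m k"
  shows "adj (A * B) = adj B * adj A"
  using assms by (intro eq_matI) (auto simp: adj_def scalar_prod_def mult.commute)

lemma index_mult_sum:
  assumes "A \<in> carrier_mat n m" "B \<in> carrier_mat m k" "i < n" "j < k"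
  shows "(A * B) $$ (i,j) = (\<Sum>l<m. A $$ (i,l) * B $$ (l,j))"
  using assms by (simp add: scalar_prod_def atLeast0LessThan)

text \<open>Complete \<open>v\<close> to a basis and orthogonalise it; Gram-Schmidt leaves the head
  of the list unchanged. Its output is orthogonal but not normalised, so each vector is divided by
  its norm, which is why the first column is only a multiple of \<open>v\<close>.\<close>

lemma unitary_with_first_column:
  fixes v :: "complex vec"
  assumes v: "v \<in> carrier_vec n" and v0: "v \<noteq> 0\<^sub>v n"
  shows "\<exists>W c. W \<in> carrier_mat n n \<and> adj W * W = 1\<^sub>m n \<and> col W 0 = c \<cdot>\<^sub>v v"
proof -
  interpret cof_vec_space n "TYPE(complex)" .
  have n: "0 < n" using v v0 by (cases n) auto
  define b where "b = basis_completion v"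
  define ws where "ws = gram_schmidt n b"
  note bc = basis_completion[OF v v0, folded b_def]
  obtain vs where bv: "b = v # vs" using bc(6,7) n by (cases b) auto
  note gs = gram_schmidt_result[OF bc(2,4,5) refl, folded ws_def]
  have hd: "hd ws = v" using gram_schmidt_hd[OF v, of vs] unfolding ws_def bv .
  have len: "length ws = n" using gs(4) bc(6) by simp
  have carr: "ws ! i \<in> carrier_vec n" if "i < n" for i using gs(3) len that by (metis nth_mem subsetD)
  have dims [simp]: "dim_vec (ws ! i) = n" if "i < n" for i using carr[OF that] by auto
  define s where "s i = (\<Sum>k<n. (cmod (ws ! i $ k))\<^sup>2)" for i
  have ip: "(\<Sum>k<n. ws ! i $ k * cnj (ws ! j $ k)) = ws ! i \<bullet>c ws ! j" if "i < n" "j < n" for i j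
    using that by (simp add: scalar_prod_def atLeast0LessThan)
  have off: "(\<Sum>k<n. ws ! i $ k * cnj (ws ! j $ k)) = 0" if "i < n" "j < n" "i \<noteq> j" for i j
    using corthogonalD[OF gs(2), of i j] ip that len by auto
  have ss: "(\<Sum>k<n. ws ! i $ k * cnj (ws ! i $ k)) = of_real (s i)" for i
    by (simp add: s_def complex_norm_square[symmetric] flip: of_real_power)
  have spos: "s i > 0" if "i < n" for i
  proof -
    have "of_real (s i) \<noteq> (0::complex)"
      using corthogonalD[OF gs(2), of i i] ip[of i i] ss[of i] that len by auto
    moreover have "s i \<ge> 0" by (simp add: s_def sum_nonneg)
    ultimately show ?thesis by simp
  qed
  define W where "W = mat n n (\<lambda>(k,i). ws ! i $ k / of_real (sqrt (s i)))"
  have W: "W \<in> carrier_mat n n" by (simp add: W_def)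
  have "adj W * W = 1\<^sub>m n"
  proof (rule eq_matI)
    fix i j assume "i < dim_row (1\<^sub>m n)" "j < dim_col (1\<^sub>m n)"
    hence ij: "i < n" "j < n" by auto
    have "(adj W * W) $$ (i,j) = (\<Sum>k<n. cnj (W $$ (k,i)) * W $$ (k,j))"
      using ij W by (simp add: scalar_prod_def adj_def atLeast0LessThan)
    also have "\<dots> = (\<Sum>k<n. (ws ! j $ k * cnj (ws ! i $ k)) / of_real (sqrt (s i) * sqrt (s j)))"
      using ij by (intro sum.cong) (auto simp: W_def)
    also have "\<dots> = (\<Sum>k<n. ws ! j $ k * cnj (ws ! i $ k)) / of_real (sqrt (s i) * sqrt (s j))"
      by (simp add: sum_divide_distrib)
    also have "\<dots> = (1\<^sub>m n) $$ (i,j)"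
      using off[of j i] ss[of i] spos[of i] ij 
      by (cases "i = j") (simp_all del: of_real_mult)
    finally show "(adj W * W) $$ (i,j) = (1\<^sub>m n) $$ (i,j)" .
  qed (use W in auto)
  moreover have "col W 0 = inverse (of_real (sqrt (s 0))) \<cdot>\<^sub>v v"
  proof -
    have "ws ! 0 = v" using hd len n by (metis hd_conv_nth length_greater_0_conv)
    thus ?thesis using n v by (intro eq_vecI) (auto simp: W_def divide_inverse)
  qed
  ultimately show ?thesis using W by blast
qed

text \<open>Deflation by induction on the dimension. In an orthonormal basis that starts with an
  eigenvector, the first column of the matrix vanishes below the diagonal; self-adjointness then
  clears the first row as well. What remains is a self-adjoint block of size \<open>m\<close>,
  diagonalised by the induction hypothesis.\<close>

lemma spectral_mat:
  assumes "A \<in> carrier_mat n n" "adj A = A"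
  shows "\<exists>U D. U \<in> carrier_mat n n \<and> D \<in> carrier_mat n n \<and> adj U * U = 1\<^sub>m n
     \<and> diagonal_mat D \<and> A = U * D * adj U"
  using assms
proof (induction n arbitrary: A)
  case 0
  then show ?case by (intro exI[of _ "1\<^sub>m 0"]) (auto simp: diagonal_mat_def adj_def)
next
  case (Suc m)
  let ?n = "Suc m"
  note A = Suc.prems(1)
  obtain as where as: "char_poly A = (\<Prod>a\<leftarrow>as. [:- a, 1:])" "length as = ?n"
    using char_poly_factorized[OF A] by blast
  then obtain e where "e \<in> set as" by (cases as) auto
  hence "poly (char_poly A) e = 0" unfolding as by (induction as) auto
  hence "eigenvalue A e" using eigenvalue_root_char_poly[OF A] by simp
  then obtain v where v: "v \<in> carrier_vec ?n" "v \<noteq> 0\<^sub>v ?n" "A *\<^sub>v v = e \<cdot>\<^sub>v v"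
    using A unfolding eigenvalue_def eigenvector_def by auto
  obtain W c where W: "W \<in> carrier_mat ?n ?n" and WW: "adj W * W = 1\<^sub>m ?n" and c: "col W 0 = c \<cdot>\<^sub>v v"
    using unitary_with_first_column[OF v(1,2)] by blast
  have W': "adj W \<in> carrier_mat ?n ?n" using W by simp
  have WW': "W * adj W = 1\<^sub>m ?n" using mat_mult_left_right_inverse[OF W' W WW] .
  define B where "B = adj W * A * W"
  have B: "B \<in> carrier_mat ?n ?n" unfolding B_def by (rule mult_carrier_mat[OF mult_carrier_mat[OF W' A] W])
  have AB: "A = W * B * adj W"
  proof -
    have "W * B * adj W = (W * adj W) * A * (W * adj W)"
      unfolding B_def using A W W' by (simp add: assoc_mult_mat[of _ ?n ?n _ ?n _ ?n] mult_carrier_mat[of _ ?n ?n _ ?n])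
    thus ?thesis using A unfolding WW' by simp
  qed
  have adjB: "adj B = B"
    unfolding B_def using A W W' Suc.prems(2)
    by (simp add: adj_mult[of _ ?n ?n _ ?n] assoc_mult_mat[of _ ?n ?n _ ?n _ ?n] mult_carrier_mat[of _ ?n ?n _ ?n])
  have colB: "col B 0 = e \<cdot>\<^sub>v col (1\<^sub>m ?n) 0"
  proof -
    have "col B 0 = adj W * A *\<^sub>v (c \<cdot>\<^sub>v v)" unfolding B_def c[symmetric] by (rule col_mult2[OF mult_carrier_mat[OF W' A] W]) simp
    also have "\<dots> = adj W *\<^sub>v (A *\<^sub>v (c \<cdot>\<^sub>v v))" using W W' A v by (simp add: assoc_mult_mat_vec[of _ ?n ?n _ ?n])
    also have "\<dots> = adj W *\<^sub>v (e \<cdot>\<^sub>v (c \<cdot>\<^sub>v v))" using A v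
      by (simp add: mult_mat_vec[OF A] smult_smult_assoc mult.commute)
    also have "\<dots> = e \<cdot>\<^sub>v (adj W *\<^sub>v col W 0)" using W W' v c by (simp add: mult_mat_vec[OF W'])
    also have "adj W *\<^sub>v col W 0 = col (adj W * W) 0" using W W' by (simp add: col_mult2[of _ ?n ?n _ ?n])
    finally show ?thesis unfolding WW .
  qed
  have B0: "B $$ (i,0) = (if i = 0 then e else 0)" if "i < ?n" for i
  proof -
    have "B $$ (i,0) = col B 0 $ i" using B that by simp
    thus ?thesis unfolding colB using that by simp
  qed
  \<comment> \<open>The row entry is the conjugate of the column entry; at \<open>i = 0\<close> the
    same symmetry shows that the eigenvalue \<open>e\<close> is real.\<close>
  have B0': "B $$ (0,i) = (if i = 0 then e else 0)" if "i < ?n" for i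
  proof -
    have "B $$ (0,i) = cnj (B $$ (i,0))" using adj_index[OF B, of 0 i] that adjB by simp
    moreover have "cnj e = e" using adj_index[OF B, of 0 0] B0[of 0] adjB by simp
    ultimately show ?thesis using B0[OF that] by auto
  qed
  define B3 where "B3 = mat m m (\<lambda>(i,j). B $$ (Suc i, Suc j))"
  have B3: "B3 \<in> carrier_mat m m" by (simp add: B3_def)
  have "adj B3 = B3" 
  proof (rule eq_matI)
    fix i j assume "i < dim_row B3" "j < dim_col B3"
    hence ij: "i < m" "j < m" using B3 by auto
    have "B $$ (Suc i, Suc j) = cnj (B $$ (Suc j, Suc i))" using adj_index[OF B, of "Suc i" "Suc j"] ij adjB by simp
    thus "adj B3 $$ (i,j) = B3 $$ (i,j)" using ij B3 adj_index[OF B3, of i j] by (simp add: B3_def)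
  qed (use B3 in \<open>auto simp: adj_def\<close>)
  then obtain U3 D3 where U3: "U3 \<in> carrier_mat m m" "D3 \<in> carrier_mat m m" "adj U3 * U3 = 1\<^sub>m m"
     "diagonal_mat D3" "B3 = U3 * D3 * adj U3" using Suc.IH[OF B3] by blast
  let ?E = "mat 1 1 (\<lambda>_. e)"
  let ?fb = "\<lambda>X Y. four_block_mat X (0\<^sub>m 1 m) (0\<^sub>m m 1) Y"
  define V where "V = ?fb (1\<^sub>m 1) U3"
  define D where "D = ?fb ?E D3"
  have V: "V \<in> carrier_mat ?n ?n" and D: "D \<in> carrier_mat ?n ?n" using U3
    by (auto simp: V_def D_def)
  have adjV: "adj V = ?fb (1\<^sub>m 1) (adj U3)"
    using U3 unfolding V_def by (intro eq_matI) (auto simp: adj_def)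
  have fbm: "?fb X Y * ?fb X' Y' = ?fb (X * X') (Y * Y')" 
    if "X \<in> carrier_mat 1 1" "X' \<in> carrier_mat 1 1" "Y \<in> carrier_mat m m" "Y' \<in> carrier_mat m m" for X Y X' Y'
    using that by (subst mult_four_block_mat[of _ 1 1 _ m _ m _ _ 1 _ m]) auto
  have VV: "adj V * V = 1\<^sub>m ?n"
    unfolding adjV unfolding V_def using U3 by (subst fbm) (auto intro!: eq_matI)
  have "B = ?fb ?E B3"
    using B B0 B0' by (intro eq_matI) (auto simp: B3_def)
  also have "\<dots> = V * D * adj V"
    unfolding adjV unfolding V_def D_def using U3 
    by (subst fbm, simp, simp, simp, simp, subst fbm) auto
  finally have BV: "B = V * D * adj V" .
  have V': "adj V \<in> carrier_mat ?n ?n" using V by simp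
  have "A = (W * V) * D * adj (W * V)"
    unfolding AB BV using W W' V V' D
    by (simp add: adj_mult[of _ ?n ?n _ ?n] assoc_mult_mat[of _ ?n ?n _ ?n _ ?n] mult_carrier_mat[of _ ?n ?n _ ?n])
  moreover have "adj (W * V) * (W * V) = 1\<^sub>m ?n"
  proof -
    have "adj (W * V) * (W * V) = adj V * (adj W * W) * V" using W W' V V'
      by (simp add: adj_mult[of _ ?n ?n _ ?n] assoc_mult_mat[of _ ?n ?n _ ?n _ ?n] mult_carrier_mat[of _ ?n ?n _ ?n])
    thus ?thesis unfolding WW using V V' VV by simp
  qed
  moreover have "diagonal_mat D" using U3 unfolding D_def diagonal_mat_def by auto
  ultimately show ?case using W V D by (intro exI[of _ "W * V"] exI[of _ D]) auto
qed

section \<open>Eigenvalue multisets, spectral data and quadratic forms\<close>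

lemma proots_prod_linear: "proots (\<Prod>a\<in>#M. [:- a, 1:]) = (M :: complex multiset)"
proof (induction M)
  case (add a M)
  have "(\<Prod>a\<in>#M. [:- a, 1:]) \<noteq> (0 :: complex poly)"
    by (auto simp: prod_mset_zero_iff)
  then show ?case using add by (simp add: proots_mult del: mult_pCons_left)
qed simp

text \<open>\<open>eigenvalue_mset\<close> is a \<open>SOME\<close> choice. A product of monic
  linear factors determines its multiset of roots, so any factorisation that is found must be the
  chosen one.\<close>

lemma eigenvalue_mset_eqI:
  assumes "char_poly A = (\<Prod>a\<in>#M. [:- a, 1:])"
  shows "eigenvalue_mset A = M"
proof -
  have "char_poly A = (\<Prod>a\<in>#eigenvalue_mset A. [:- a, 1:])"
    unfolding eigenvalue_mset_def by (rule someI[of _ M]) (rule assms)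
  thus ?thesis using assms by (metis proots_prod_linear)
qed

definition orthonormal :: "nat \<Rightarrow> nat \<Rightarrow> (nat \<Rightarrow> nat \<Rightarrow> complex) \<Rightarrow> bool" where
  "orthonormal k n u \<longleftrightarrow> (\<forall>l<k. \<forall>l'<k. (\<Sum>i<n. cnj (u l i) * u l' i) = (if l = l' then 1 else 0))"

text \<open>The vector \<open>u l\<close> is column \<open>l\<close> of the diagonalising unitary;
  its two unitarity relations give orthonormality and completeness. The diagonal entries are real
  because \<open>D\<close> is self-adjoint. Trace powers are read off from \<open>D\<close>, since
  similar matrices have the same characteristic polynomial and that of a diagonal matrix factors
  over its diagonal.\<close>

lemma hermitian_spectral:
  assumes "hermitian_mat n A"
  obtains u :: "nat \<Rightarrow> nat \<Rightarrow> complex" and \<mu> :: "nat \<Rightarrow> real" where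
    "orthonormal n n u"
    "\<And>i j. i < n \<Longrightarrow> j < n \<Longrightarrow> (\<Sum>l<n. u l i * cnj (u l j)) = (if i = j then 1 else 0)"
    "\<And>i j. i < n \<Longrightarrow> j < n \<Longrightarrow> A $$ (i,j) = (\<Sum>l<n. of_real (\<mu> l) * u l i * cnj (u l j))"
    "\<And>p. trace_power A p = (\<Sum>l<n. \<mu> l powr p)"
proof -
  have A: "A \<in> carrier_mat n n" using assms by (simp add: hermitian_mat_def)
  have "adj A = A"
  proof (rule eq_matI)
    fix i j assume "i < dim_row A" "j < dim_col A"
    thus "adj A $$ (i,j) = A $$ (i,j)"
      using assms A adj_index[OF A, of i j] unfolding hermitian_mat_def by (metis carrier_matD)
  qed (use A in auto)
  then obtain U D where UD: "U \<in> carrier_mat n n" "D \<in> carrier_mat n n" "adj U * U = 1\<^sub>m n"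
     "diagonal_mat D" "A = U * D * adj U" using spectral_mat[OF A] by blast
  have U': "adj U \<in> carrier_mat n n" using UD by simp
  have UU': "U * adj U = 1\<^sub>m n" using mat_mult_left_right_inverse[OF U' UD(1,3)] .
  have Dd: "D $$ (i,j) = 0" if "i < n" "j < n" "i \<noteq> j" for i j
    using UD(2,4) that by (auto simp: diagonal_mat_def)
  have "D = (adj U * U) * D * (adj U * U)" unfolding UD(3) using UD(2) by simp
  also have "\<dots> = adj U * A * U" unfolding UD(5) using UD(1,2) U'
    by (simp add: assoc_mult_mat[of _ n n _ n _ n] mult_carrier_mat[of _ n n _ n])
  finally have DA: "D = adj U * A * U" .
  have "adj D = D" unfolding DA using UD(1) U' A \<open>adj A = A\<close>
    by (simp add: adj_mult[of _ n n _ n] assoc_mult_mat[of _ n n _ n _ n] mult_carrier_mat[of _ n n _ n])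
  hence real: "D $$ (i,i) = of_real (Re (D $$ (i,i)))" if "i < n" for i
    using adj_index[OF UD(2), of i i] that by (simp add: complex_eq_iff)
  define u where "u l i = U $$ (i,l)" for l i
  define \<mu> where "\<mu> l = Re (D $$ (l,l))" for l
  have "orthonormal n n u" unfolding orthonormal_def
  proof (intro allI impI)
    fix l l' assume l: "l < n" "l' < n"
    have "(\<Sum>i<n. cnj (u l i) * u l' i) = (adj U * U) $$ (l,l')"
      using l UD(1) by (simp add: scalar_prod_def u_def atLeast0LessThan)
    thus "(\<Sum>i<n. cnj (u l i) * u l' i) = (if l = l' then 1 else 0)" unfolding UD(3) using l by simp
  qed
  moreover have "(\<Sum>l<n. u l i * cnj (u l j)) = (if i = j then 1 else 0)" if "i < n" "j < n" for i j
  proof -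
    have "(\<Sum>l<n. u l i * cnj (u l j)) = (U * adj U) $$ (i,j)"
      using that UD(1) by (simp add: scalar_prod_def u_def atLeast0LessThan)
    thus ?thesis unfolding UU' using that by simp
  qed
  moreover have "A $$ (i,j) = (\<Sum>l<n. of_real (\<mu> l) * u l i * cnj (u l j))" if "i < n" "j < n" for i j
  proof -
    have UDe: "(U * D) $$ (i,l) = U $$ (i,l) * D $$ (l,l)" if "l < n" for l
    proof -
      have "(U * D) $$ (i,l) = (\<Sum>k<n. U $$ (i,k) * D $$ (k,l))"
        using \<open>i < n\<close> that UD(1,2) by (simp add: scalar_prod_def atLeast0LessThan)
      also have "\<dots> = (\<Sum>k<n. if k = l then U $$ (i,l) * D $$ (l,l) else 0)"
        using that Dd by (intro sum.cong) auto
      finally show ?thesis using that by simp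
    qed
    have "A $$ (i,j) = (\<Sum>l<n. (U * D) $$ (i,l) * cnj (U $$ (j,l)))"
      using that UD(1) unfolding UD(5) index_mult_sum[OF mult_carrier_mat[OF UD(1,2)] U' that]
      by (intro sum.cong) auto
    also have "\<dots> = (\<Sum>l<n. of_real (\<mu> l) * u l i * cnj (u l j))"
      using UDe real by (intro sum.cong) (auto simp: u_def \<mu>_def mult_ac)
    finally show ?thesis .
  qed
  moreover have "trace_power A p = (\<Sum>l<n. \<mu> l powr p)" for p
  proof -
    have "similar_mat_wit A D U (adj U)" unfolding similar_mat_wit_def Let_def
      using A UD(1-3) UU' U' by (intro conjI UD(5)) auto
    hence "similar_mat A D" unfolding similar_mat_def by blast
    hence "char_poly A = char_poly D" by (rule char_poly_similar)
    also have "\<dots> = (\<Prod>a\<leftarrow>diag_mat D. [:- a, 1:])"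
      using UD(2,4) by (intro char_poly_upper_triangular) (auto simp: diagonal_mat_def)
    also have "\<dots> = (\<Prod>a\<in>#mset (diag_mat D). [:- a, 1:])" by (metis mset_map prod_mset_prod_list)
    finally have "eigenvalue_mset A = mset (diag_mat D)" by (rule eigenvalue_mset_eqI)
    hence "trace_power A p = (\<Sum>x\<leftarrow>diag_mat D. Re x powr p)"
      unfolding trace_power_def by (metis mset_map sum_mset_sum_list)
    also have "\<dots> = (\<Sum>l<n. \<mu> l powr p)"
      using UD(2) by (simp add: diag_mat_def \<mu>_def o_def interv_sum_list_conv_sum_set_nat atLeast0LessThan)
    finally show ?thesis .
  qed
  ultimately show ?thesis by (rule that)
qed

definition qform :: "nat \<Rightarrow> complex mat \<Rightarrow> (nat \<Rightarrow> complex) \<Rightarrow> complex" where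
  "qform n A v = (\<Sum>i<n. \<Sum>j<n. cnj (v i) * A $$ (i,j) * v j)"

text \<open>\<open>qform n\<close> reads only the coordinates below \<open>n\<close>, so arbitrary
  functions may replace vectors of \<open>carrier_vec n\<close>. All later computations then stay
  inside finite sums.\<close>

lemma psd_mat_iff: "psd_mat n A \<longleftrightarrow> hermitian_mat n A \<and> (\<forall>v. 0 \<le> Re (qform n A v))"
proof -
  have 1: "(\<Sum>i<n. \<Sum>j<n. cnj (v $ i) * A $$ (i,j) * v $ j) = qform n A (\<lambda>i. v $ i)" for v :: "complex vec"
    by (simp add: qform_def)
  have 2: "qform n A v = qform n A (\<lambda>i. vec n v $ i)" for v
    by (simp add: qform_def)
  show ?thesis unfolding psd_mat_def 1 using 2 by (metis vec_carrier)
qed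

section \<open>Trace powers of density operators\<close>

lemma ex_nonzero_of_sum_1: "(\<Sum>l<n. f l) = (1::real) \<Longrightarrow> \<exists>l<n. f l \<noteq> 0"
  by (rule ccontr) simp

text \<open>Bundles a spectral decomposition with the consequences used later (completeness, trace
  powers, the quadratic form in the eigenbasis), so that a single fact can be passed around.\<close>

definition eigensystem :: "nat \<Rightarrow> complex mat \<Rightarrow> (nat \<Rightarrow> nat \<Rightarrow> complex) \<Rightarrow> (nat \<Rightarrow> real) \<Rightarrow> bool" where
  "eigensystem n \<sigma> u \<mu> \<longleftrightarrow> orthonormal n n u \<and>
    (\<forall>i<n. \<forall>j<n. (\<Sum>l<n. u l i * cnj (u l j)) = (if i = j then 1 else 0)) \<and>
    (\<forall>i<n. \<forall>j<n. \<sigma> $$ (i,j) = (\<Sum>l<n. of_real (\<mu> l) * u l i * cnj (u l j))) \<and>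
    (\<forall>p. trace_power \<sigma> p = (\<Sum>l<n. \<mu> l powr p)) \<and>
    (\<forall>v. qform n \<sigma> v = of_real (\<Sum>l<n. \<mu> l * (cmod (\<Sum>i<n. cnj (u l i) * v i))\<^sup>2)) \<and>
    (\<forall>l<n. qform n \<sigma> (u l) = of_real (\<mu> l))"

lemma eigensystemD:
  assumes "eigensystem n \<sigma> u \<mu>"
  shows "orthonormal n n u"
    "\<And>i j. i < n \<Longrightarrow> j < n \<Longrightarrow> (\<Sum>l<n. u l i * cnj (u l j)) = (if i = j then 1 else 0)"
    "\<And>i j. i < n \<Longrightarrow> j < n \<Longrightarrow> \<sigma> $$ (i,j) = (\<Sum>l<n. of_real (\<mu> l) * u l i * cnj (u l j))"
    "\<And>p. trace_power \<sigma> p = (\<Sum>l<n. \<mu> l powr p)"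
    "\<And>v. qform n \<sigma> v = of_real (\<Sum>l<n. \<mu> l * (cmod (\<Sum>i<n. cnj (u l i) * v i))\<^sup>2)"
    "\<And>l. l < n \<Longrightarrow> qform n \<sigma> (u l) = of_real (\<mu> l)"
proof -
  note E = assms[unfolded eigensystem_def]
  show "orthonormal n n u" using E by (rule conjunct1)
  note E = E[THEN conjunct2]
  show "(\<Sum>l<n. u l i * cnj (u l j)) = (if i = j then 1 else 0)" if "i < n" "j < n" for i j
    using E[THEN conjunct1, rule_format, OF that] .
  note E = E[THEN conjunct2]
  show "\<sigma> $$ (i,j) = (\<Sum>l<n. of_real (\<mu> l) * u l i * cnj (u l j))" if "i < n" "j < n" for i j
    using E[THEN conjunct1, rule_format, OF that] .
  note E = E[THEN conjunct2]
  show "trace_power \<sigma> p = (\<Sum>l<n. \<mu> l powr p)" for p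
    using E[THEN conjunct1, rule_format] .
  note E = E[THEN conjunct2]
  show "qform n \<sigma> v = of_real (\<Sum>l<n. \<mu> l * (cmod (\<Sum>i<n. cnj (u l i) * v i))\<^sup>2)" for v
    using E[THEN conjunct1, rule_format] .
  show "qform n \<sigma> (u l) = of_real (\<mu> l)" if "l < n" for l
    using E[THEN conjunct2, rule_format, OF that] .
qed

lemma hermitian_eigensystem:
  assumes h: "hermitian_mat n \<sigma>"
  obtains u \<mu> where "eigensystem n \<sigma> u \<mu>" "mat_trace \<sigma> = of_real (\<Sum>l<n. \<mu> l)"
proof -
  obtain u :: "nat \<Rightarrow> nat \<Rightarrow> complex" and \<mu> :: "nat \<Rightarrow> real" where u: "orthonormal n n u"
    "\<And>i j. i < n \<Longrightarrow> j < n \<Longrightarrow> (\<Sum>l<n. u l i * cnj (u l j)) = (if i = j then 1 else 0)"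
    "\<And>i j. i < n \<Longrightarrow> j < n \<Longrightarrow> \<sigma> $$ (i,j) = (\<Sum>l<n. of_real (\<mu> l) * u l i * cnj (u l j))"
    "\<And>p. trace_power \<sigma> p = (\<Sum>l<n. \<mu> l powr p)"
    by (rule hermitian_spectral[OF h]) (rule that)
  have qf: "qform n \<sigma> v = of_real (\<Sum>l<n. \<mu> l * (cmod (\<Sum>i<n. cnj (u l i) * v i))\<^sup>2)" for v
  proof -
    have "qform n \<sigma> v = (\<Sum>i<n. \<Sum>j<n. \<Sum>l<n. of_real (\<mu> l) * (cnj (v i) * u l i) * (cnj (u l j) * v j))"
      unfolding qform_def using u(3) by (intro sum.cong) (auto simp: sum_distrib_left sum_distrib_right mult_ac)
    also have "\<dots> = (\<Sum>l<n. \<Sum>i<n. \<Sum>j<n. of_real (\<mu> l) * (cnj (v i) * u l i) * (cnj (u l j) * v j))"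
      by (subst sum.swap, subst (2) sum.swap) (rule refl)
    also have "\<dots> = (\<Sum>l<n. of_real (\<mu> l) * (cnj (\<Sum>i<n. cnj (u l i) * v i) * (\<Sum>i<n. cnj (u l i) * v i)))"
      by (simp add: sum_product sum_distrib_left mult_ac)
    also have "\<dots> = of_real (\<Sum>l<n. \<mu> l * (cmod (\<Sum>i<n. cnj (u l i) * v i))\<^sup>2)"
      by (simp add: complex_norm_square mult.commute del: of_real_power)
    finally show ?thesis .
  qed
  have qfu: "qform n \<sigma> (u l) = of_real (\<mu> l)" if "l < n" for l
  proof -
    have "(\<Sum>k<n. \<mu> k * (cmod (\<Sum>i<n. cnj (u k i) * u l i))\<^sup>2) = (\<Sum>k<n. if k = l then \<mu> l else 0)"
      using u(1) that by (intro sum.cong) (auto simp: orthonormal_def)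
    thus ?thesis using that by (simp add: qf)
  qed
  have "mat_trace \<sigma> = (\<Sum>i<n. \<sigma> $$ (i,i))"
    using h[unfolded hermitian_mat_def, THEN conjunct1] by (auto simp: mat_trace_def)
  also have "\<dots> = (\<Sum>i<n. \<Sum>l<n. of_real (\<mu> l) * (cnj (u l i) * u l i))"
    using u(3) by (intro sum.cong) (auto simp: mult_ac)
  also have "\<dots> = (\<Sum>l<n. of_real (\<mu> l) * (\<Sum>i<n. cnj (u l i) * u l i))"
    by (subst sum.swap) (simp add: sum_distrib_left)
  also have "\<dots> = (\<Sum>l<n. of_real (\<mu> l))"
    using u(1) by (intro sum.cong) (auto simp: orthonormal_def)
  finally have "mat_trace \<sigma> = of_real (\<Sum>l<n. \<mu> l)" by simp
  moreover have "eigensystem n \<sigma> u \<mu>"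
    unfolding eigensystem_def by (intro conjI allI impI u qf qfu)
  ultimately show ?thesis using that by blast
qed

lemma density_spectral:
  assumes "density_op n \<sigma>"
  obtains u \<mu> where "eigensystem n \<sigma> u \<mu>" "\<And>l. l < n \<Longrightarrow> 0 \<le> \<mu> l" "(\<Sum>l<n. \<mu> l) = 1"
proof -
  have psd: "psd_mat n \<sigma>" and tr: "mat_trace \<sigma> = 1" using assms by (auto simp: density_op_def)
  obtain u \<mu> where E: "eigensystem n \<sigma> u \<mu>" and "mat_trace \<sigma> = of_real (\<Sum>l<n. \<mu> l)"
    using hermitian_eigensystem psd unfolding psd_mat_def by blast
  hence "complex_of_real (\<Sum>l<n. \<mu> l) = of_real 1" using tr by simp
  hence "(\<Sum>l<n. \<mu> l) = 1" unfolding of_real_eq_iff .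
  moreover have "0 \<le> \<mu> l" if "l < n" for l
  proof -
    have "0 \<le> Re (qform n \<sigma> (u l))" using psd psd_mat_iff by blast
    thus ?thesis using eigensystemD(6)[OF E that] by simp
  qed
  ultimately show ?thesis using that E by blast
qed

text \<open>Different eigenvectors stay orthogonal for the form defined by \<open>A\<close>. When
  \<open>A\<close> is a Gram matrix, this says that their images are orthogonal, which is how an
  isometry is obtained later.\<close>

lemma eigensystem_sesquilinear:
  assumes E: "eigensystem n A u \<mu>" and l: "l < n" "l' < n"
  shows "(\<Sum>i<n. \<Sum>j<n. cnj (u l i) * A $$ (i,j) * u l' j) = (if l = l' then of_real (\<mu> l) else 0)"
proof -
  have o: "(\<Sum>i<n. cnj (u a i) * u b i) = (if a = b then 1 else 0)" if "a < n" "b < n" for a b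
    using eigensystemD(1)[OF E] that unfolding orthonormal_def by blast
  have "(\<Sum>i<n. \<Sum>j<n. cnj (u l i) * A $$ (i,j) * u l' j)
    = (\<Sum>i<n. \<Sum>j<n. \<Sum>m<n. of_real (\<mu> m) * (cnj (u l i) * u m i) * (cnj (u m j) * u l' j))"
    using eigensystemD(3)[OF E] by (intro sum.cong) (auto simp: sum_distrib_left sum_distrib_right mult_ac)
  also have "\<dots> = (\<Sum>m<n. \<Sum>i<n. \<Sum>j<n. of_real (\<mu> m) * (cnj (u l i) * u m i) * (cnj (u m j) * u l' j))"
    by (subst sum.swap, subst (2) sum.swap) (rule refl)
  also have "\<dots> = (\<Sum>m<n. of_real (\<mu> m) * (\<Sum>i<n. cnj (u l i) * u m i) * (\<Sum>j<n. cnj (u m j) * u l' j))"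
    by (simp only: sum_distrib_left[of "of_real _"] sum_product)
  also have "\<dots> = (\<Sum>m<n. if m = l then (if l = l' then of_real (\<mu> l) else 0) else 0)"
    using l by (intro sum.cong) (auto simp: o)
  also have "\<dots> = (if l = l' then of_real (\<mu> l) else 0)" using l by simp
  finally show ?thesis .
qed

lemma trace_power_density_pos:
  assumes "density_op n \<sigma>"
  shows "0 < trace_power \<sigma> p"
proof -
  obtain u \<mu> where E: "eigensystem n \<sigma> u \<mu>" and m: "\<And>l. l < n \<Longrightarrow> 0 \<le> \<mu> l" "(\<Sum>l<n. \<mu> l) = 1"
    using density_spectral[OF assms] by blast
  note m = m eigensystemD(4)[OF E]
  have "\<exists>l<n. \<mu> l \<noteq> 0" using m(2) by (intro ex_nonzero_of_sum_1)
  then obtain l where "l < n" "\<mu> l \<noteq> 0" by blast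
  thus ?thesis unfolding m(3) by (intro sum_pos2[of _ l]) auto
qed

text \<open>All eigenvalues lie in [0,1], where raising to a power of at least 1 does not increase
  them. This supplies the boundedness that the infimum of entropies and the supremum of norms
  require.\<close>

lemma trace_power_density_le_1:
  assumes "density_op n \<sigma>" "1 \<le> p"
  shows "trace_power \<sigma> p \<le> 1"
proof -
  obtain u \<mu> where E: "eigensystem n \<sigma> u \<mu>" and m: "\<And>l. l < n \<Longrightarrow> 0 \<le> \<mu> l" "(\<Sum>l<n. \<mu> l) = 1"
    using density_spectral[OF assms(1)] by blast
  note m = m eigensystemD(4)[OF E]
  have "\<mu> l powr p \<le> \<mu> l" if "l < n" for l
  proof -
    have "\<mu> l \<le> 1" using m(1) that unfolding m(2)[symmetric] by (intro member_le_sum) auto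
    hence "\<mu> l powr p \<le> \<mu> l powr 1" using m(1)[OF that] assms(2) by (intro powr_mono') auto
    thus ?thesis using m(1)[OF that] by (simp add: powr_one_gt_zero_iff)
  qed
  hence "(\<Sum>l<n. \<mu> l powr p) \<le> (\<Sum>l<n. \<mu> l)" by (intro sum_mono) auto
  thus ?thesis using m by simp
qed

text \<open>In the eigenbasis the quadratic form at a unit vector is a weighted average of the
  eigenvalues, so some eigenvalue is at least \<open>t\<close>, and its power alone gives the
  bound.\<close>

lemma trace_power_ge_qform:
  assumes "density_op n \<sigma>" and w: "(\<Sum>i<n. (cmod (w i))\<^sup>2) = 1" and "t \<le> Re (qform n \<sigma> w)" "0 \<le> t" "0 < p"
  shows "t powr p \<le> trace_power \<sigma> p"
proof -
  obtain u \<mu> where E: "eigensystem n \<sigma> u \<mu>" and pos: "\<And>l. l < n \<Longrightarrow> 0 \<le> \<mu> l"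
    using density_spectral[OF assms(1)] by blast
  note m = pos eigensystemD(2,4,5)[OF E]
  define c where "c l = (cmod (\<Sum>i<n. cnj (u l i) * w i))\<^sup>2" for l
  \<comment> \<open>Parseval, from the completeness relation of the eigenvectors: the weights
    \<open>c l\<close> sum to 1.\<close>
  have "complex_of_real (\<Sum>l<n. c l) = (\<Sum>l<n. (\<Sum>i<n. cnj (u l i) * w i) * cnj (\<Sum>i<n. cnj (u l i) * w i))"
    by (simp only: c_def complex_norm_square of_real_sum)
  also have "\<dots> = (\<Sum>l<n. \<Sum>i<n. \<Sum>j<n. (u l j * cnj (u l i)) * (w i * cnj (w j)))"
    by (simp add: sum_product mult_ac)
  also have "\<dots> = (\<Sum>i<n. \<Sum>j<n. \<Sum>l<n. (u l j * cnj (u l i)) * (w i * cnj (w j)))"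
    by (subst sum.swap, subst (2) sum.swap) (rule refl)
  also have "\<dots> = (\<Sum>i<n. \<Sum>j<n. if j = i then w i * cnj (w i) else 0)"
    using m(2) by (intro sum.cong) (auto simp flip: sum_distrib_right)
  also have "\<dots> = of_real (\<Sum>i<n. (cmod (w i))\<^sup>2)" by (simp add: complex_norm_square del: of_real_power)
  finally have c1: "(\<Sum>l<n. c l) = 1" unfolding of_real_eq_iff w by simp
  have "\<exists>l<n. t \<le> \<mu> l"
  proof (rule ccontr)
    assume "\<not> ?thesis"
    hence lt: "\<mu> l < t" if "l < n" for l using that by (meson not_le)
    have "\<exists>l<n. c l \<noteq> 0" using c1 by (intro ex_nonzero_of_sum_1)
    then obtain l where l: "l < n" "c l > 0" by (auto simp: c_def)
    have "(\<Sum>l<n. \<mu> l * c l) < (\<Sum>l<n. t * c l)"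
    proof (rule sum_strict_mono_ex1)
      show "\<forall>x\<in>{..<n}. \<mu> x * c x \<le> t * c x"
      proof
        fix x assume "x \<in> {..<n}"
        hence "\<mu> x \<le> t" using lt[of x] by auto
        thus "\<mu> x * c x \<le> t * c x" by (rule mult_right_mono) (simp add: c_def)
      qed
      show "\<exists>x\<in>{..<n}. \<mu> x * c x < t * c x"
        using l lt by (auto intro!: bexI[of _ l] mult_strict_right_mono)
    qed simp
    thus False using assms(3) c1 by (simp add: m(4) c_def flip: sum_distrib_left)
  qed
  then obtain l where l: "l < n" "t \<le> \<mu> l" by blast
  have "t powr p \<le> \<mu> l powr p" using l assms by (intro powr_mono2) auto
  also have "\<dots> \<le> (\<Sum>l<n. \<mu> l powr p)" using l by (intro member_le_sum) auto
  finally show ?thesis by (simp add: m(3))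
qed

text \<open>Controlling the mass of \<open>k\<close>-dimensional projections for a single \<open>k\<close> suffices: fewer than
  \<open>k\<close> eigenvalues can then exceed \<open>c / n\<close>.\<close>

lemma trace_power_le_of_frames:
  assumes dens: "density_op n \<sigma>" and p: "1 < p" and k: "0 < k" "k \<le> n" and c: "0 < c"
    and frames: "\<And>q. orthonormal k n q \<Longrightarrow> Re (\<Sum>l<k. qform n \<sigma> (q l)) \<le> c * k / n"
  shows "trace_power \<sigma> p \<le> (c / n) powr (p - 1) + (c * k / n) powr p"
proof -
  obtain u \<mu> where E: "eigensystem n \<sigma> u \<mu>" and m: "\<And>l. l < n \<Longrightarrow> 0 \<le> \<mu> l" "(\<Sum>l<n. \<mu> l) = 1"
    using density_spectral[OF dens] by blast
  note u = eigensystemD(1)[OF E]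
  note m = m eigensystemD(4,6)[OF E]
  have T: "(\<Sum>l\<in>T. \<mu> l) \<le> c * k / n" if T: "T \<subseteq> {..<n}" "card T = k" for T
  proof -
    obtain h where h: "bij_betw h {..<k} T"
      using T by (metis finite_lessThan finite_subset finite_same_card_bij card_lessThan)
    have hn: "h l < n" if "l < k" for l using h T that by (auto simp: bij_betw_def)
    have "orthonormal k n (\<lambda>l. u (h l))"
      using u hn h by (auto simp: orthonormal_def bij_betw_def inj_on_def)
    from frames[OF this] have "(\<Sum>l<k. \<mu> (h l)) \<le> c * k / n" using hn m(4) by simp
    thus ?thesis using sum.reindex_bij_betw[OF h, of \<mu>] by simp
  qed
  define T0 where "T0 = {l. l < n \<and> \<mu> l > c / n}"
  have fT0: "finite T0" "T0 \<subseteq> {..<n}" by (auto simp: T0_def)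
  have "card T0 < k"
  proof (rule ccontr)
    assume "\<not> ?thesis"
    then obtain T where T1: "T \<subseteq> T0" "card T = k" and k0: "k > 0" using k by (metis obtain_subset_with_card_n not_less)
    have "T \<noteq> {}" "finite T" using T1 k0 fT0 by (auto intro: finite_subset)
    hence "(\<Sum>l\<in>T. c / n) < (\<Sum>l\<in>T. \<mu> l)" using T1 by (intro sum_strict_mono) (auto simp: T0_def)
    thus False using T[of T] T1 fT0 by (auto simp: mult.commute)
  qed
  hence "card T0 \<le> k" using k by auto
  \<comment> \<open>Pad the set of large eigenvalues to exactly \<open>k\<close> indices, so that
    the frame hypothesis bounds their sum. Every eigenvalue outside \<open>T\<close> is still at
    most \<open>c / n\<close>.\<close>
  then obtain T where T1: "T0 \<subseteq> T" "T \<subseteq> {..<n}" "card T = k"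
    using exists_subset_between[of T0 k "{..<n}"] fT0 k by auto
  define s where "s = (\<Sum>l\<in>T. \<mu> l)"
  have fT: "finite T" using T1 finite_subset by blast
  have s: "s \<le> c * k / n" "0 \<le> s" using T[OF T1(2,3)] m(1) T1(2) by (auto simp: s_def intro!: sum_nonneg)
  have split: "x powr p = x * x powr (p - 1)" if "0 \<le> x" for x :: real
    using that by (cases "x = 0") (auto simp: powr_diff)
  \<comment> \<open>On \<open>T\<close> each eigenvalue is at most the total \<open>s\<close>, hence
    the powers sum to at most \<open>s powr p\<close>.\<close>
  have "(\<Sum>l\<in>T. \<mu> l powr p) \<le> (\<Sum>l\<in>T. \<mu> l * s powr (p - 1))"
  proof (intro sum_mono)
    fix l assume l: "l \<in> T"
    have "\<mu> l \<le> s" unfolding s_def using l fT T1 m(1) by (intro member_le_sum) auto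
    moreover have "0 \<le> \<mu> l" using l T1 m(1)[of l] by auto
    ultimately show "\<mu> l powr p \<le> \<mu> l * s powr (p - 1)" using p
      by (simp add: split[of "\<mu> l"] mult_left_mono powr_mono2)
  qed
  also have "\<dots> = s powr p" using split[OF s(2)] by (simp add: s_def flip: sum_distrib_right)
  also have "\<dots> \<le> (c * k / n) powr p" using s p by (intro powr_mono2) auto
  finally have 1: "(\<Sum>l\<in>T. \<mu> l powr p) \<le> (c * k / n) powr p" .
  have "(\<Sum>l\<in>{..<n}-T. \<mu> l powr p) \<le> (\<Sum>l\<in>{..<n}-T. \<mu> l * (c / n) powr (p - 1))"
  proof (intro sum_mono)
    fix l assume l: "l \<in> {..<n} - T"
    hence "\<mu> l \<le> c / n" using T1 by (auto simp: T0_def)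
    moreover have "0 \<le> \<mu> l" using l m(1)[of l] by auto
    ultimately show "\<mu> l powr p \<le> \<mu> l * (c / n) powr (p - 1)" using p
      by (simp add: split[of "\<mu> l"] mult_left_mono powr_mono2)
  qed
  also have "\<dots> = (\<Sum>l\<in>{..<n}-T. \<mu> l) * (c / n) powr (p - 1)" by (simp add: sum_distrib_right)
  also have "\<dots> \<le> (\<Sum>l<n. \<mu> l) * (c / n) powr (p - 1)"
    using m(1) by (intro mult_right_mono sum_mono2) auto
  finally have 2: "(\<Sum>l\<in>{..<n}-T. \<mu> l powr p) \<le> (c / n) powr (p - 1)" by (simp add: m(2))
  have "trace_power \<sigma> p = (\<Sum>l\<in>{..<n}-T. \<mu> l powr p) + (\<Sum>l\<in>T. \<mu> l powr p)"
    unfolding m(3) using T1(2) by (intro sum.subset_diff) auto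
  thus ?thesis using 1 2 by linarith
qed

section \<open>Channels in Kraus form\<close>

text \<open>For fixed \<open>\<kappa>\<close> the matrix with entries \<open>V i \<kappa> j\<close>
  is one Kraus operator. Read with row index \<open>(i,\<kappa>)\<close>, the same array is the
  Stinespring operator into output times environment, and the sum over \<open>\<kappa>\<close> is
  the partial trace over the environment.\<close>

definition kraus :: "nat \<Rightarrow> nat \<Rightarrow> nat \<Rightarrow> (nat \<Rightarrow> nat \<Rightarrow> nat \<Rightarrow> complex) \<Rightarrow> complex mat \<Rightarrow> complex mat" where
  "kraus d n e V A = mat d d (\<lambda>(i,i'). \<Sum>\<kappa><e. \<Sum>j<n. \<Sum>j'<n. V i \<kappa> j * A $$ (j,j') * cnj (V i' \<kappa> j'))"

definition isometry :: "nat \<Rightarrow> nat \<Rightarrow> nat \<Rightarrow> (nat \<Rightarrow> nat \<Rightarrow> nat \<Rightarrow> complex) \<Rightarrow> bool" where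
  "isometry d n e V \<longleftrightarrow> (\<forall>j<n. \<forall>j'<n. (\<Sum>i<d. \<Sum>\<kappa><e. cnj (V i \<kappa> j) * V i \<kappa> j') = (if j = j' then 1 else 0))"

lemma sum_swap3:
  "(\<Sum>a\<in>A. \<Sum>b\<in>B. \<Sum>c\<in>C. h a b c) = (\<Sum>b\<in>B. \<Sum>c\<in>C. \<Sum>a\<in>A. h a b c)"
  by (subst sum.swap) (rule sum.cong[OF refl], rule sum.swap)

lemma sum_sum_mult:
  "(\<Sum>a\<in>A. \<Sum>b\<in>B. x * p a * q b) = x * sum p A * (sum q B :: complex)"
  by (simp only: sum_distrib_left[of x] sum_product)

lemma kraus_carrier [simp]: "kraus d n e V A \<in> carrier_mat d d"
  by (simp add: kraus_def)

text \<open>Moves the Kraus operators to the test vector: the argument on the right is the adjoint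
  of the operator numbered \<open>\<kappa>\<close>, applied to \<open>v\<close>. Positivity, the
  frame bounds and the overlap with the maximally entangled state all rest on this formula.\<close>

lemma qform_kraus:
  "qform d (kraus d n e V A) v = (\<Sum>\<kappa><e. qform n A (\<lambda>j. \<Sum>i<d. cnj (V i \<kappa> j) * v i))"
proof -
  have "qform d (kraus d n e V A) v =
     (\<Sum>i<d. \<Sum>i'<d. \<Sum>\<kappa><e. \<Sum>j<n. \<Sum>j'<n. (cnj (v i) * V i \<kappa> j) * A $$ (j,j') * (cnj (V i' \<kappa> j') * v i'))"
    unfolding qform_def by (intro sum.cong) (auto simp: kraus_def sum_distrib_left sum_distrib_right mult_ac)
  also have "\<dots> = (\<Sum>\<kappa><e. \<Sum>i<d. \<Sum>i'<d. \<Sum>j<n. \<Sum>j'<n. (cnj (v i) * V i \<kappa> j) * A $$ (j,j') * (cnj (V i' \<kappa> j') * v i'))"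
    by (subst sum.swap[of _ "{..<e}"], subst sum.swap[of _ "{..<e}"]) (rule refl)
  also have "\<dots> = (\<Sum>\<kappa><e. qform n A (\<lambda>j. \<Sum>i<d. cnj (V i \<kappa> j) * v i))"
  proof (rule sum.cong[OF refl])
    fix \<kappa>
    let ?f = "\<lambda>i i' j j'. (cnj (v i) * V i \<kappa> j) * A $$ (j,j') * (cnj (V i' \<kappa> j') * v i')"
    have "(\<Sum>i<d. \<Sum>i'<d. \<Sum>j<n. \<Sum>j'<n. ?f i i' j j') = (\<Sum>i<d. \<Sum>j<n. \<Sum>i'<d. \<Sum>j'<n. ?f i i' j j')"
      by ((rule sum.cong[OF refl])+, rule sum.swap)
    also have "\<dots> = (\<Sum>j<n. \<Sum>i<d. \<Sum>j'<n. \<Sum>i'<d. ?f i i' j j')"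
      by (subst sum.swap) ((rule sum.cong[OF refl])+, rule sum.swap)
    also have "\<dots> = (\<Sum>j<n. \<Sum>j'<n. \<Sum>i<d. \<Sum>i'<d. ?f i i' j j')"
      by ((rule sum.cong[OF refl])+, rule sum.swap)
    also have "\<dots> = qform n A (\<lambda>j. \<Sum>i<d. cnj (V i \<kappa> j) * v i)"
      unfolding qform_def by (simp add: sum_distrib_left sum_distrib_right mult_ac)
    finally show "(\<Sum>i<d. \<Sum>i'<d. \<Sum>j<n. \<Sum>j'<n. ?f i i' j j') = qform n A (\<lambda>j. \<Sum>i<d. cnj (V i \<kappa> j) * v i)" .
  qed
  finally show ?thesis .
qed

lemma hermitian_kraus:
  assumes "hermitian_mat n A"
  shows "hermitian_mat d (kraus d n e V A)"
proof -
  have A: "A $$ (j',j) = cnj (A $$ (j,j'))" if "j < n" "j' < n" for j j'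
    using assms that unfolding hermitian_mat_def by blast
  have "kraus d n e V A $$ (i',i) = cnj (kraus d n e V A $$ (i,i'))" if i: "i < d" "i' < d" for i i'
  proof -
    have "cnj (kraus d n e V A $$ (i,i')) = (\<Sum>\<kappa><e. \<Sum>j<n. \<Sum>j'<n. V i' \<kappa> j' * cnj (A $$ (j,j')) * cnj (V i \<kappa> j))"
      using i by (simp add: kraus_def mult_ac)
    also have "\<dots> = (\<Sum>\<kappa><e. \<Sum>j<n. \<Sum>j'<n. V i' \<kappa> j' * A $$ (j',j) * cnj (V i \<kappa> j))"
      by (intro sum.cong refl) (metis A lessThan_iff)
    also have "\<dots> = (\<Sum>\<kappa><e. \<Sum>j'<n. \<Sum>j<n. V i' \<kappa> j' * A $$ (j',j) * cnj (V i \<kappa> j))"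
      by (rule sum.cong[OF refl], rule sum.swap)
    finally show ?thesis using i by (simp add: kraus_def)
  qed
  thus ?thesis unfolding hermitian_mat_def by (intro conjI allI impI kraus_carrier) blast
qed

lemma psd_kraus: "psd_mat n A \<Longrightarrow> psd_mat d (kraus d n e V A)"
  unfolding psd_mat_iff qform_kraus by (auto intro!: sum_nonneg hermitian_kraus)

lemma trace_kraus:
  assumes V: "isometry d n e V" and A: "A \<in> carrier_mat n n"
  shows "mat_trace (kraus d n e V A) = mat_trace A"
proof -
  have "mat_trace (kraus d n e V A) = (\<Sum>i<d. \<Sum>\<kappa><e. \<Sum>j<n. \<Sum>j'<n. A $$ (j,j') * (cnj (V i \<kappa> j') * V i \<kappa> j))"
    by (simp add: mat_trace_def kraus_def mult_ac)
  also have "\<dots> = (\<Sum>i<d. \<Sum>j<n. \<Sum>j'<n. \<Sum>\<kappa><e. A $$ (j,j') * (cnj (V i \<kappa> j') * V i \<kappa> j))"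
    by (rule sum.cong[OF refl], rule sum_swap3)
  also have "\<dots> = (\<Sum>j<n. \<Sum>j'<n. \<Sum>i<d. \<Sum>\<kappa><e. A $$ (j,j') * (cnj (V i \<kappa> j') * V i \<kappa> j))"
    by (rule sum_swap3)
  also have "\<dots> = (\<Sum>j<n. \<Sum>j'<n. A $$ (j,j') * (\<Sum>i<d. \<Sum>\<kappa><e. cnj (V i \<kappa> j') * V i \<kappa> j))"
    by (simp add: sum_distrib_left)
  also have "\<dots> = (\<Sum>j<n. \<Sum>j'<n. if j' = j then A $$ (j,j) else 0)"
    using V by (intro sum.cong) (auto simp: isometry_def)
  also have "\<dots> = mat_trace A" using A by (simp add: mat_trace_def)
  finally show ?thesis .
qed

lemma density_kraus:
  assumes "isometry d n e V" "density_op n A"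
  shows "density_op d (kraus d n e V A)"
proof -
  have "A \<in> carrier_mat n n" using assms(2) by (simp add: density_op_def psd_mat_def hermitian_mat_def)
  thus ?thesis using assms by (simp add: density_op_def psd_kraus trace_kraus)
qed

lemma lin_map_kraus: "lin_map n d (kraus d n e V)"
  unfolding lin_map_def
proof (intro conjI ballI allI)
  fix A B :: "complex mat" and c :: complex assume "A \<in> carrier_mat n n"
  then show "kraus d n e V (c \<cdot>\<^sub>m A) = c \<cdot>\<^sub>m kraus d n e V A"
    by (intro eq_matI) (auto simp: kraus_def sum_distrib_left mult_ac)
  assume "A \<in> carrier_mat n n" "B \<in> carrier_mat n n"
  then show "kraus d n e V (A + B) = kraus d n e V A + kraus d n e V B"
    by (intro eq_matI) (auto simp: kraus_def sum.distrib distrib_left distrib_right)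
qed simp

text \<open>The ampliation is again in Kraus form, with each operator tensored with the identity:
  the condition on the \<open>div\<close> parts is the identity factor. Complete positivity thus
  reduces to \<open>psd_kraus\<close>.\<close>

lemma ampliation_kraus:
  assumes "0 < n"
  shows "ampliation k n d (kraus d n e V) X =
    kraus (k*d) (k*n) e (\<lambda>I \<kappa> P. if P div n = I div d then V (I mod d) \<kappa> (P mod n) else 0) X"
    (is "?L = kraus _ _ _ ?W X")
proof (rule eq_matI)
  fix I J assume "I < dim_row (kraus (k*d) (k*n) e ?W X)" "J < dim_col (kraus (k*d) (k*n) e ?W X)"
  hence IJ: "I < k*d" "J < k*d" by (auto simp: kraus_def)
  hence d: "0 < d" by (cases d) auto
  have dv: "I div d < k" "J div d < k" using IJ by (auto simp: less_mult_imp_div_less)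
  have inner: "(\<Sum>P<k*n. if P div n = s then f P else 0) = (\<Sum>u<n. f (s*n+u))"
    if "s < k" for f :: "nat \<Rightarrow> complex" and s
  proof -
    have "(\<Sum>P<k*n. if P div n = s then f P else 0) = (\<Sum>t<k. \<Sum>u<n. if (u + t*n) div n = s then f (u + t*n) else 0)"
      by (rule sum_mult_product)
    also have "\<dots> = (\<Sum>t<k. if t = s then (\<Sum>u<n. f (u + s*n)) else 0)"
      by (intro sum.cong refl) auto
    finally show ?thesis using that by (simp add: add.commute)
  qed
  have "kraus (k*d) (k*n) e ?W X $$ (I,J) = (\<Sum>\<kappa><e. \<Sum>P<k*n. if P div n = I div d then
      (\<Sum>Q<k*n. if Q div n = J div d then V (I mod d) \<kappa> (P mod n) * X $$ (P,Q) * cnj (V (J mod d) \<kappa> (Q mod n)) else 0) else 0)"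
    using IJ by (auto simp: kraus_def intro!: sum.cong)
  also have "\<dots> = (\<Sum>\<kappa><e. \<Sum>u<n. \<Sum>w<n. V (I mod d) \<kappa> u * X $$ (I div d * n + u, J div d * n + w) * cnj (V (J mod d) \<kappa> w))"
    using dv by (simp add: inner)
  also have "\<dots> = ?L $$ (I,J)"
    using IJ d by (simp add: ampliation_def kraus_def)
  finally show "?L $$ (I,J) = kraus (k*d) (k*n) e ?W X $$ (I,J)" ..
qed (auto simp: ampliation_def kraus_def)

lemma quantum_channel_kraus:
  assumes "isometry d n e V" "0 < n" "0 < d"
  shows "quantum_channel n d (kraus d n e V)"
  unfolding quantum_channel_def completely_positive_def trace_preserving_def
  using assms by (auto simp: lin_map_kraus trace_kraus ampliation_kraus psd_kraus)

section \<open>Tensor products of channels in Kraus form\<close>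

lemma kraus_mat_unit:
  assumes "a < n" "b < n" "i < d" "i' < d"
  shows "kraus d n e V (mat_unit n a b) $$ (i,i') = (\<Sum>\<kappa><e. V i \<kappa> a * cnj (V i' \<kappa> b))"
proof -
  have "(\<Sum>j<n. \<Sum>j'<n. V i \<kappa> j * (if j = a \<and> j' = b then 1 else 0) * cnj (V i' \<kappa> j'))
      = V i \<kappa> a * cnj (V i' \<kappa> b)" for \<kappa>
  proof -
    have "(\<Sum>j<n. \<Sum>j'<n. V i \<kappa> j * (if j = a \<and> j' = b then 1 else 0) * cnj (V i' \<kappa> j'))
      = (\<Sum>j<n. \<Sum>j'<n. if j' = b then (if j = a then V i \<kappa> a * cnj (V i' \<kappa> b) else 0) else 0)"
      by (intro sum.cong refl) auto
    thus ?thesis using assms by simp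
  qed
  thus ?thesis using assms by (simp add: kraus_def mat_unit_def)
qed

definition tensor_kraus :: "nat \<Rightarrow> nat \<Rightarrow> nat \<Rightarrow> (nat \<Rightarrow> nat \<Rightarrow> nat \<Rightarrow> complex) \<Rightarrow> (nat \<Rightarrow> nat \<Rightarrow> nat \<Rightarrow> complex)
    \<Rightarrow> nat \<Rightarrow> nat \<Rightarrow> nat \<Rightarrow> complex" where
  "tensor_kraus d e n V W I K J = V (I div d) (K div e) (J div n) * W (I mod d) (K mod e) (J mod n)"

text \<open>Expanding both channels on matrix units and regrouping the sums shows that the product
  channel has the pairwise tensor products as Kraus operators. Every lemma on \<open>kraus\<close>
  therefore applies to it.\<close>

lemma tensor_channel_kraus:
  "tensor_channel n1 d1 n2 d2 (kraus d1 n1 e1 V) (kraus d2 n2 e2 W) X =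
   kraus (d1*d2) (n1*n2) (e1*e2) (tensor_kraus d2 e2 n2 V W) X"
proof (rule eq_matI)
  fix I J assume "I < dim_row (kraus (d1*d2) (n1*n2) (e1*e2) (tensor_kraus d2 e2 n2 V W) X)"
    "J < dim_col (kraus (d1*d2) (n1*n2) (e1*e2) (tensor_kraus d2 e2 n2 V W) X)"
  hence IJ: "I < d1*d2" "J < d1*d2" by (auto simp: kraus_def)
  hence d: "0 < d2" by (cases d2) auto
  have dv: "I div d2 < d1" "J div d2 < d1" "I mod d2 < d2" "J mod d2 < d2"
    using IJ d by (auto simp: less_mult_imp_div_less)
  let ?V = "\<lambda>\<kappa> a. V (I div d2) \<kappa> a" and ?V' = "\<lambda>\<kappa> b. V (J div d2) \<kappa> b"
  let ?W = "\<lambda>\<kappa> a. W (I mod d2) \<kappa> a" and ?W' = "\<lambda>\<kappa> b. W (J mod d2) \<kappa> b"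
  let ?f = "\<lambda>\<kappa> \<kappa>' a b c g. X $$ (a*n2 + c, b*n2 + g) * (?V \<kappa> a * cnj (?V' \<kappa> b)) * (?W \<kappa>' c * cnj (?W' \<kappa>' g))"
  let ?T = "tensor_kraus d2 e2 n2 V W"
  have "kraus (d1*d2) (n1*n2) (e1*e2) ?T X $$ (I,J) =
     (\<Sum>K<e1*e2. \<Sum>P<n1*n2. \<Sum>Q<n1*n2. ?T I K P * X $$ (P,Q) * cnj (?T J K Q))"
    using IJ by (simp add: kraus_def)
  also have "\<dots> = (\<Sum>\<kappa><e1. \<Sum>\<kappa>'<e2. \<Sum>a<n1. \<Sum>c<n2. \<Sum>b<n1. \<Sum>g<n2. ?f \<kappa> \<kappa>' a b c g)"
    unfolding sum_mult_product
    by (intro sum.cong refl) (simp add: tensor_kraus_def add.commute mult_ac)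
  also have "\<dots> = (\<Sum>\<kappa><e1. \<Sum>\<kappa>'<e2. \<Sum>a<n1. \<Sum>b<n1. \<Sum>c<n2. \<Sum>g<n2. ?f \<kappa> \<kappa>' a b c g)"
    by ((rule sum.cong[OF refl])+, rule sum.swap)
  also have "\<dots> = (\<Sum>a<n1. \<Sum>b<n1. \<Sum>c<n2. \<Sum>g<n2. \<Sum>\<kappa><e1. \<Sum>\<kappa>'<e2. ?f \<kappa> \<kappa>' a b c g)"
    by (rule trans[OF sum_swap3[symmetric]], rule sum.cong[OF refl], rule trans[OF sum_swap3[symmetric]], rule sum.cong[OF refl], rule trans[OF sum_swap3[symmetric]], rule sum.cong[OF refl], rule sum_swap3[symmetric])
  also have "\<dots> = (\<Sum>a<n1. \<Sum>b<n1. \<Sum>c<n2. \<Sum>g<n2. X $$ (a*n2 + c, b*n2 + g) *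
      (\<Sum>\<kappa><e1. ?V \<kappa> a * cnj (?V' \<kappa> b)) * (\<Sum>\<kappa>'<e2. ?W \<kappa>' c * cnj (?W' \<kappa>' g)))"
    by (simp only: sum_sum_mult)
  also have "\<dots> = tensor_channel n1 d1 n2 d2 (kraus d1 n1 e1 V) (kraus d2 n2 e2 W) X $$ (I,J)"
    using IJ dv by (simp add: tensor_channel_def kraus_mat_unit)
  finally show "tensor_channel n1 d1 n2 d2 (kraus d1 n1 e1 V) (kraus d2 n2 e2 W) X $$ (I,J) =
    kraus (d1*d2) (n1*n2) (e1*e2) (tensor_kraus d2 e2 n2 V W) X $$ (I,J)" ..
qed (auto simp: tensor_channel_def kraus_def)

lemma isometry_tensor:
  assumes V: "isometry d1 n1 e1 V" and W: "isometry d2 n2 e2 W"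
  shows "isometry (d1*d2) (n1*n2) (e1*e2) (tensor_kraus d2 e2 n2 V W)"
  unfolding isometry_def
proof (intro allI impI)
  fix J J' assume J: "J < n1*n2" "J' < n1*n2"
  hence n2: "0 < n2" by (cases n2) auto
  have b: "J div n2 < n1" "J' div n2 < n1" "J mod n2 < n2" "J' mod n2 < n2"
    using J n2 by (auto simp: less_mult_imp_div_less)
  let ?V = "\<lambda>i \<kappa>. cnj (V i \<kappa> (J div n2)) * V i \<kappa> (J' div n2)"
  let ?W = "\<lambda>i \<kappa>. cnj (W i \<kappa> (J mod n2)) * W i \<kappa> (J' mod n2)"
  have "(\<Sum>I<d1*d2. \<Sum>K<e1*e2. cnj (tensor_kraus d2 e2 n2 V W I K J) * tensor_kraus d2 e2 n2 V W I K J') =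
    (\<Sum>i<d1. \<Sum>i'<d2. \<Sum>\<kappa><e1. \<Sum>\<kappa>'<e2. ?V i \<kappa> * ?W i' \<kappa>')"
    unfolding sum_mult_product by (intro sum.cong refl) (simp add: tensor_kraus_def mult_ac)
  also have "\<dots> = (\<Sum>i<d1. \<Sum>\<kappa><e1. ?V i \<kappa>) * (\<Sum>i<d2. \<Sum>\<kappa><e2. ?W i \<kappa>)"
    by (simp add: sum_product)
  also have "\<dots> = (if J div n2 = J' div n2 then 1 else 0) * (if J mod n2 = J' mod n2 then 1 else 0)"
    using V W b by (simp add: isometry_def)
  also have "\<dots> = (if J = J' then 1 else 0)" 
  proof -
    have "J div n2 = J' div n2 \<and> J mod n2 = J' mod n2 \<longleftrightarrow> J = J'" by (metis div_mult_mod_eq)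
    thus ?thesis by auto
  qed
  finally show "(\<Sum>I<d1*d2. \<Sum>K<e1*e2. cnj (tensor_kraus d2 e2 n2 V W I K J) * tensor_kraus d2 e2 n2 V W I K J') =
    (if J = J' then 1 else 0)" .
qed

section \<open>Frame bounds and the maximally entangled input\<close>

text \<open>The double sum is the trace of the output on the pure input \<open>a\<close>, compressed
  to the span of the frame \<open>q\<close>: the mass that the output puts on this
  \<open>k\<close>-dimensional subspace.\<close>

definition frame_bound :: "nat \<Rightarrow> nat \<Rightarrow> nat \<Rightarrow> (nat \<Rightarrow> nat \<Rightarrow> nat \<Rightarrow> complex) \<Rightarrow> nat \<Rightarrow> real \<Rightarrow> bool" where
  "frame_bound d n e V k c \<longleftrightarrow> (\<forall>a q. (\<Sum>j<n. (cmod (a j))\<^sup>2) = 1 \<longrightarrow> orthonormal k d q \<longrightarrow>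
     (\<Sum>l<k. \<Sum>\<kappa><e. (cmod (\<Sum>i<d. cnj (q l i) * (\<Sum>j<n. V i \<kappa> j * a j)))\<^sup>2) \<le> c)"

lemma isometry_cnj:
  assumes "isometry d n e V"
  shows "isometry d n e (\<lambda>i \<kappa> j. cnj (V i \<kappa> j))"
  unfolding isometry_def
proof (intro allI impI)
  fix j j' assume "j < n" "j' < n"
  hence "(\<Sum>i<d. \<Sum>\<kappa><e. cnj (V i \<kappa> j) * V i \<kappa> j') = (if j = j' then 1 else 0)"
    using assms unfolding isometry_def by blast
  from arg_cong[OF this, of cnj] show "(\<Sum>i<d. \<Sum>\<kappa><e. cnj (cnj (V i \<kappa> j)) * cnj (V i \<kappa> j')) = (if j = j' then 1 else 0)"
    by (simp split: if_splits)
qed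

lemma orthonormal_cnj:
  assumes "orthonormal k d q"
  shows "orthonormal k d (\<lambda>l i. cnj (q l i))"
  unfolding orthonormal_def
proof (intro allI impI)
  fix j j' assume "j < k" "j' < k"
  hence "(\<Sum>i<d. cnj (q j i) * q j' i) = (if j = j' then 1 else 0)"
    using assms unfolding orthonormal_def by blast
  from arg_cong[OF this, of cnj] show "(\<Sum>i<d. cnj (cnj (q j i)) * cnj (q j' i)) = (if j = j' then 1 else 0)"
    by (simp split: if_splits)
qed

text \<open>Conjugating operator, input and frame together conjugates each amplitude and keeps its
  modulus; unit vectors and frames are preserved. So the conjugate channel inherits the
  bound.\<close>

lemma frame_bound_cnj:
  assumes "frame_bound d n e V k c"
  shows "frame_bound d n e (\<lambda>i \<kappa> j. cnj (V i \<kappa> j)) k c"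
  unfolding frame_bound_def
proof (intro allI impI)
  fix a q assume a: "(\<Sum>j<n. (cmod (a j))\<^sup>2) = 1" and q: "orthonormal k d q"
  have "(\<Sum>l<k. \<Sum>\<kappa><e. (cmod (\<Sum>i<d. cnj (cnj (q l i)) * (\<Sum>j<n. V i \<kappa> j * cnj (a j))))\<^sup>2) \<le> c"
    using assms[unfolded frame_bound_def, rule_format, of "\<lambda>j. cnj (a j)" "\<lambda>l i. cnj (q l i)"] a
      orthonormal_cnj[OF q] by simp
  moreover have "cmod (\<Sum>i<d. cnj (cnj (q l i)) * (\<Sum>j<n. V i \<kappa> j * cnj (a j))) =
      cmod (\<Sum>i<d. cnj (q l i) * (\<Sum>j<n. cnj (V i \<kappa> j) * a j))" for l \<kappa>
    by (subst complex_mod_cnj[symmetric]) simp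
  ultimately show "(\<Sum>l<k. \<Sum>\<kappa><e. (cmod (\<Sum>i<d. cnj (q l i) * (\<Sum>j<n. cnj (V i \<kappa> j) * a j)))\<^sup>2) \<le> c"
    by simp
qed

text \<open>A density operator is a convex mixture of its unit eigenvectors and the mass on a frame
  is linear in the input, so the bound for pure inputs extends to mixed ones. The maximal
  \<open>p\<close>-norm, a supremum over all density operators, calls for this form.\<close>

lemma frame_bound_density:
  assumes V: "frame_bound d n e V k c" and \<rho>: "density_op n \<rho>" and q: "orthonormal k d q"
  shows "Re (\<Sum>l<k. qform d (kraus d n e V \<rho>) (q l)) \<le> c"
proof -
  obtain u \<mu> where E: "eigensystem n \<rho> u \<mu>" and m: "\<And>l. l < n \<Longrightarrow> 0 \<le> \<mu> l" "(\<Sum>l<n. \<mu> l) = 1"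
    using density_spectral[OF \<rho>] by blast
  define S where "S l m \<kappa> = (cmod (\<Sum>i<d. cnj (q l i) * (\<Sum>j<n. V i \<kappa> j * u m j)))\<^sup>2" for l m \<kappa>
  have S: "(cmod (\<Sum>j<n. cnj (u m j) * (\<Sum>i<d. cnj (V i \<kappa> j) * q l i)))\<^sup>2 = S l m \<kappa>" for l m \<kappa>
  proof -
    have "(\<Sum>j<n. cnj (u m j) * (\<Sum>i<d. cnj (V i \<kappa> j) * q l i)) = (\<Sum>j<n. \<Sum>i<d. q l i * (cnj (V i \<kappa> j) * cnj (u m j)))"
      by (simp add: sum_distrib_left mult_ac)
    also have "\<dots> = cnj (\<Sum>i<d. cnj (q l i) * (\<Sum>j<n. V i \<kappa> j * u m j))"
      by (subst sum.swap) (simp add: sum_distrib_left)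
    finally show ?thesis by (simp only: S_def complex_mod_cnj)
  qed
  have unit: "(\<Sum>j<n. (cmod (u m j))\<^sup>2) = 1" if "m < n" for m
  proof -
    have "complex_of_real (\<Sum>j<n. (cmod (u m j))\<^sup>2) = (\<Sum>j<n. cnj (u m j) * u m j)"
      by (simp only: of_real_sum complex_norm_square mult.commute)
    also have "\<dots> = of_real 1" using eigensystemD(1)[OF E] that by (simp add: orthonormal_def)
    finally show ?thesis unfolding of_real_eq_iff .
  qed
  have "Re (\<Sum>l<k. qform d (kraus d n e V \<rho>) (q l)) = (\<Sum>l<k. \<Sum>\<kappa><e. \<Sum>m<n. \<mu> m * S l m \<kappa>)"
    unfolding qform_kraus eigensystemD(5)[OF E] S by simp
  also have "\<dots> = (\<Sum>m<n. \<Sum>l<k. \<Sum>\<kappa><e. \<mu> m * S l m \<kappa>)"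
    by (rule sum_swap3[symmetric])
  also have "\<dots> = (\<Sum>m<n. \<mu> m * (\<Sum>l<k. \<Sum>\<kappa><e. S l m \<kappa>))"
    by (simp add: sum_distrib_left)
  also have "\<dots> \<le> (\<Sum>m<n. \<mu> m * c)"
  proof (intro sum_mono mult_left_mono)
    fix m' assume "m' \<in> {..<n}"
    thus "(\<Sum>l<k. \<Sum>\<kappa><e. S l m' \<kappa>) \<le> c"
      using V[unfolded frame_bound_def, rule_format, OF unit q] by (simp add: S_def)
  qed (use m in auto)
  also have "\<dots> = c" using m by (simp flip: sum_distrib_right)
  finally show ?thesis .
qed

section \<open>Pure states and the maximally entangled vector\<close>

lemma qform_pure_state:
  assumes "v \<in> carrier_vec n"
  shows "qform n (pure_state n v) y = of_real ((cmod (\<Sum>j<n. cnj (vec_index v j) * y j))\<^sup>2)"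
proof -
  have "qform n (pure_state n v) y = (\<Sum>i<n. \<Sum>j<n. (cnj (y i) * vec_index v i) * (cnj (vec_index v j) * y j))"
    by (simp add: qform_def pure_state_def mult_ac)
  also have "\<dots> = (\<Sum>i<n. cnj (y i) * vec_index v i) * (\<Sum>j<n. cnj (vec_index v j) * y j)"
    by (rule sum_product[symmetric])
  also have "\<dots> = (\<Sum>j<n. cnj (vec_index v j) * y j) * cnj (\<Sum>j<n. cnj (vec_index v j) * y j)"
    by (simp add: mult.commute)
  finally show ?thesis by (simp only: complex_norm_square)
qed

lemma density_pure_state:
  assumes "v \<in> unit_vecs n"
  shows "density_op n (pure_state n v)"
proof -
  have v: "v \<in> carrier_vec n" "(\<Sum>i<n. (cmod (vec_index v i))\<^sup>2) = 1" using assms by (auto simp: unit_vecs_def)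
  have "mat_trace (pure_state n v) = complex_of_real (\<Sum>i<n. (cmod (vec_index v i))\<^sup>2)"
    by (simp only: of_real_sum complex_norm_square) (simp add: mat_trace_def pure_state_def)
  moreover have "hermitian_mat n (pure_state n v)"
    by (auto simp: hermitian_mat_def pure_state_def)
  ultimately show ?thesis using v by (simp add: density_op_def psd_mat_iff qform_pure_state)
qed

definition max_entangled :: "nat \<Rightarrow> complex vec" where
  "max_entangled n = vec (n * n) (\<lambda>J. if J div n = J mod n then 1 / of_real (sqrt n) else 0)"

lemma pair_index_less:
  fixes i j n :: nat
  assumes "i < n" "j < n"
  shows "j + i * n < n * n"
proof -
  have "j + i * n < n + i * n" using assms by simp
  also have "\<dots> \<le> n * n" using assms mult_le_mono1[of "Suc i" n n] by simp
  finally show ?thesis .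
qed

lemma sum_max_entangled:
  "(\<Sum>J<n*n. vec_index (max_entangled n) J * f J) = (\<Sum>j<n. f (j + j * n)) / of_real (sqrt n)"
proof -
  have "(\<Sum>J<n*n. vec_index (max_entangled n) J * f J) =
    (\<Sum>i<n. \<Sum>j<n. vec_index (max_entangled n) (j + i * n) * f (j + i * n))"
    by (rule sum_mult_product)
  also have "\<dots> = (\<Sum>i<n. \<Sum>j<n. if j = i then f (i + i * n) / of_real (sqrt n) else 0)"
    using pair_index_less by (intro sum.cong refl) (auto simp: max_entangled_def)
  also have "\<dots> = (\<Sum>j<n. f (j + j * n)) / of_real (sqrt n)"
    by (simp add: sum_divide_distrib)
  finally show ?thesis .
qed

lemma cnj_max_entangled: "J < n * n \<Longrightarrow> cnj (vec_index (max_entangled n) J) = vec_index (max_entangled n) J"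
  by (simp add: max_entangled_def)

lemma max_entangled_norm:
  assumes "0 < n"
  shows "(\<Sum>J<n*n. (cmod (vec_index (max_entangled n) J))\<^sup>2) = 1"
proof -
  have "complex_of_real (\<Sum>J<n*n. (cmod (vec_index (max_entangled n) J))\<^sup>2)
    = (\<Sum>J<n*n. vec_index (max_entangled n) J * vec_index (max_entangled n) J)"
    by (simp only: of_real_sum complex_norm_square) (simp add: cnj_max_entangled)
  also have "\<dots> = (\<Sum>j<n. vec_index (max_entangled n) (j + j * n)) / of_real (sqrt n)"
    by (rule sum_max_entangled)
  also have "\<dots> = of_real 1"
    using assms pair_index_less by (simp add: max_entangled_def flip: of_real_mult)
  finally show ?thesis unfolding of_real_eq_iff .
qed

lemma max_entangled_unit: "0 < n \<Longrightarrow> max_entangled n \<in> unit_vecs (n * n)"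
  using max_entangled_norm by (auto simp: unit_vecs_def max_entangled_def)

text \<open>The Kraus operators of the product are pairs of one operator and one conjugate operator.
  A pair of equal indices \<open>\<kappa>\<close> has amplitude
  \<open>t \<kappa> / sqrt (n * d)\<close> between the two maximally entangled vectors, where
  \<open>t \<kappa>\<close> is a squared Hilbert-Schmidt norm. The isometry condition gives
  \<open>t\<close> the sum \<open>n\<close>, so by Cauchy-Schwarz its squares sum to at least
  \<open>n^2 / e\<close>. Unequal pairs contribute nonnegatively and are dropped.\<close>

lemma max_entangled_overlap:
  assumes V: "isometry d n e V" and pos: "0 < n" "0 < d" "0 < e"
  shows "real n / (real d * real e) \<le> Re (qform (d*d) (kraus (d*d) (n*n) (e*e)
     (tensor_kraus d e n V (\<lambda>i \<kappa> j. cnj (V i \<kappa> j))) (pure_state (n*n) (max_entangled n)))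
     (vec_index (max_entangled d)))"
proof -
  let ?T = "tensor_kraus d e n V (\<lambda>i \<kappa> j. cnj (V i \<kappa> j))"
  define t where "t \<kappa> = (\<Sum>j<n. \<Sum>i<d. (cmod (V i \<kappa> j))\<^sup>2)" for \<kappa>
  \<comment> \<open>The conjugate of the amplitude of the product Kraus operator \<open>K\<close>
    between the two maximally entangled vectors.\<close>
  define Z where "Z K = (\<Sum>J<n*n. cnj (vec_index (max_entangled n) J) * (\<Sum>I<d*d. cnj (?T I K J) * vec_index (max_entangled d) I))" for K
  have Z: "Z (\<kappa> + \<kappa> * e) = of_real (t \<kappa> / (sqrt n * sqrt d))" if "\<kappa> < e" for \<kappa>
  proof -
    have "Z (\<kappa> + \<kappa> * e) = (\<Sum>J<n*n. vec_index (max_entangled n) J * (\<Sum>I<d*d. vec_index (max_entangled d) I * cnj (?T I (\<kappa> + \<kappa> * e) J)))"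
      unfolding Z_def by (intro sum.cong refl) (simp add: cnj_max_entangled mult.commute)
    also have "\<dots> = (\<Sum>j<n. \<Sum>i<d. cnj (?T (i + i * d) (\<kappa> + \<kappa> * e) (j + j * n))) / of_real (sqrt n * sqrt d)"
      unfolding sum_max_entangled by (simp add: sum_divide_distrib mult.commute)
    also have "(\<Sum>j<n. \<Sum>i<d. cnj (?T (i + i * d) (\<kappa> + \<kappa> * e) (j + j * n))) = (\<Sum>j<n. \<Sum>i<d. of_real ((cmod (V i \<kappa> j))\<^sup>2))"
      using that by (intro sum.cong refl, simp only: complex_norm_square) (simp add: tensor_kraus_def)
    finally show ?thesis by (simp add: t_def)
  qed
  have "complex_of_real (\<Sum>\<kappa><e. t \<kappa>) = (\<Sum>\<kappa><e. \<Sum>j<n. \<Sum>i<d. cnj (V i \<kappa> j) * V i \<kappa> j)"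
    unfolding t_def of_real_sum complex_norm_square by (simp add: mult.commute)
  also have "\<dots> = (\<Sum>j<n. \<Sum>i<d. \<Sum>\<kappa><e. cnj (V i \<kappa> j) * V i \<kappa> j)"
    by (rule sum_swap3)
  also have "\<dots> = (\<Sum>j<n. 1)" 
  proof (rule sum.cong[OF refl])
    fix j assume "j \<in> {..<n}"
    thus "(\<Sum>i<d. \<Sum>\<kappa><e. cnj (V i \<kappa> j) * V i \<kappa> j) = 1"
      using V[unfolded isometry_def, rule_format, of j j] by (simp only: lessThan_iff if_True simp_thms)
  qed
  also have "\<dots> = of_real (real n)" by simp
  finally have t: "(\<Sum>\<kappa><e. t \<kappa>) = real n" unfolding of_real_eq_iff .
  have "real n / (real d * real e) = (real n)\<^sup>2 / (real n * real d * real e)"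
    using pos by (simp add: power2_eq_square)
  also have "(real n)\<^sup>2 \<le> real e * (\<Sum>\<kappa><e. (t \<kappa>)\<^sup>2)"
    using sum_squared_le_sum_of_squares[of t "{..<e}"] by (simp add: t mult.commute)
  hence "(real n)\<^sup>2 / (real n * real d * real e) \<le> real e * (\<Sum>\<kappa><e. (t \<kappa>)\<^sup>2) / (real n * real d * real e)"
    by (rule divide_right_mono) simp
  also have "\<dots> = (\<Sum>\<kappa><e. (t \<kappa>)\<^sup>2 / (real n * real d))"
    using pos by (simp add: sum_divide_distrib)
  also have "\<dots> = (\<Sum>\<kappa><e. (cmod (Z (\<kappa> + \<kappa> * e)))\<^sup>2)"
    by (intro sum.cong refl, subst Z) (auto simp: power_divide power_mult_distrib norm_divide norm_mult)
  also have "\<dots> \<le> (\<Sum>\<kappa><e. \<Sum>\<kappa>'<e. (cmod (Z (\<kappa>' + \<kappa> * e)))\<^sup>2)"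
    by (intro sum_mono member_le_sum[of _ "{..<e}" "\<lambda>\<kappa>'. (cmod (Z (\<kappa>' + _ * e)))\<^sup>2"]) auto
  also have "\<dots> = (\<Sum>K<e*e. (cmod (Z K))\<^sup>2)" by (rule sum_mult_product[symmetric])
  also have "\<dots> = Re (qform (d*d) (kraus (d*d) (n*n) (e*e) ?T (pure_state (n*n) (max_entangled n))) (vec_index (max_entangled d)))"
    unfolding qform_kraus by (subst qform_pure_state) (auto simp: Z_def max_entangled_def)
  finally show ?thesis .
qed

section \<open>Random sign tensors\<close>

lemma tanh_le_self:
  fixes x :: real assumes "0 \<le> x" shows "tanh x \<le> x"
proof -
  have "0 - tanh 0 \<le> x - tanh x"
  proof (rule DERIV_nonneg_imp_nondecreasing[OF assms])
    fix y :: real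
    have "((\<lambda>x. x - tanh x) has_real_derivative 1 - (1 - (tanh y)\<^sup>2)) (at y)"
      by (auto intro!: derivative_eq_intros)
    thus "\<exists>D. ((\<lambda>x. x - tanh x) has_real_derivative D) (at y) \<and> 0 \<le> D"
      by (intro exI conjI) auto
  qed
  thus ?thesis by simp
qed

text \<open>The derivative of \<open>t^2 / 2 - ln (cosh t)\<close> is \<open>t - tanh t\<close>,
  nonnegative for \<open>t \<ge> 0\<close>; negative arguments follow because both sides are
  even.\<close>

lemma cosh_le_exp_half_square: "cosh x \<le> exp (x\<^sup>2 / 2)" for x :: real
proof -
  have *: "cosh y \<le> exp (y\<^sup>2 / 2)" if y: "0 \<le> y" for y :: real
  proof -
    have "0\<^sup>2 / 2 - ln (cosh 0) \<le> y\<^sup>2 / 2 - ln (cosh y)"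
    proof (rule DERIV_nonneg_imp_nondecreasing[OF y])
      fix t :: real assume t: "0 \<le> t"
      have "((\<lambda>t. t\<^sup>2 / 2 - ln (cosh t)) has_real_derivative t - tanh t) (at t)"
        by (auto intro!: derivative_eq_intros simp: tanh_def)
      thus "\<exists>D. ((\<lambda>t. t\<^sup>2 / 2 - ln (cosh t)) has_real_derivative D) (at t) \<and> 0 \<le> D"
        using tanh_le_self[OF t] by (intro exI conjI) auto
    qed
    hence "ln (cosh y) \<le> y\<^sup>2 / 2" by simp
    thus ?thesis by (metis cosh_real_pos exp_le_cancel_iff exp_ln)
  qed
  show ?thesis using *[of x] *[of "- x"] by (cases "0 \<le> x") auto
qed

text \<open>The exponential factors over coordinates, and each independent sign contributes
  \<open>2 * cosh (c x)\<close>. Averages are written as sums over all sign patterns, so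
  \<open>2 ^ card X\<close> is just the number of patterns.\<close>

lemma rademacher_mgf:
  assumes "finite X"
  shows "(\<Sum>\<omega>\<in>PiE X (\<lambda>_. {1,-1}). exp (\<Sum>x\<in>X. \<omega> x * c x)) \<le> 2 ^ card X * exp ((\<Sum>x\<in>X. (c x)\<^sup>2) / 2 :: real)"
proof -
  have "(\<Sum>\<omega>\<in>PiE X (\<lambda>_. {1,-1}). exp (\<Sum>x\<in>X. \<omega> x * c x)) =
      (\<Sum>\<omega>\<in>PiE X (\<lambda>_. {1,-1}). \<Prod>x\<in>X. exp (\<omega> x * c x))"
    using assms by (simp add: exp_sum)
  also have "\<dots> = (\<Prod>x\<in>X. \<Sum>y\<in>{1,-1}. exp (y * c x))"
    using assms by (intro prod_sum_PiE[symmetric]) auto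
  also have "\<dots> = (\<Prod>x\<in>X. 2 * cosh (c x))"
    by (intro prod.cong) (auto simp: cosh_def)
  also have "\<dots> \<le> (\<Prod>x\<in>X. 2 * exp ((c x)\<^sup>2 / 2))"
    by (intro prod_mono conjI mult_left_mono cosh_le_exp_half_square) auto
  also have "\<dots> = 2 ^ card X * exp ((\<Sum>x\<in>X. (c x)\<^sup>2) / 2)"
    using assms by (simp add: prod.distrib exp_sum sum_divide_distrib)
  finally show ?thesis .
qed

text \<open>Completing the square turns the integrand into a constant times the normal density with
  mean \<open>z / sqrt 2\<close>.\<close>

lemma gaussian_linear_exp:
  "has_bochner_integral lborel (\<lambda>x. exp (x * z / sqrt 2) * std_normal_density x) (exp (z\<^sup>2 / 4))"
proof -
  have "has_bochner_integral lborel (\<lambda>x. exp (z\<^sup>2 / 4) * normal_density (z / sqrt 2) 1 x) (exp (z\<^sup>2 / 4) * 1)"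
    by (intro has_bochner_integral_mult_right) (simp add: has_bochner_integral_iff integrable_normal_density integral_normal_density)
  also have "(\<lambda>x. exp (z\<^sup>2 / 4) * normal_density (z / sqrt 2) 1 x) = (\<lambda>x. exp (x * z / sqrt 2) * std_normal_density x)"
  proof
    fix x
    have "z\<^sup>2 / 4 - (x - z / sqrt 2)\<^sup>2 / 2 = x * z / sqrt 2 - x\<^sup>2 / 2"
      by (simp add: power2_diff power_divide field_simps)
    hence "exp (z\<^sup>2 / 4) * exp (- (x - z / sqrt 2)\<^sup>2 / 2) = exp (x * z / sqrt 2) * exp (- x\<^sup>2 / 2)"
      by (simp flip: exp_add)
    thus "exp (z\<^sup>2 / 4) * normal_density (z / sqrt 2) 1 x = exp (x * z / sqrt 2) * std_normal_density x"
      by (simp add: normal_density_def)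
  qed
  finally show ?thesis by simp
qed

text \<open>The integrand is \<open>sqrt 2\<close> times the density of a centred normal variable of
  variance 2.\<close>

lemma gaussian_square_exp:
  "has_bochner_integral lborel (\<lambda>x. exp (x\<^sup>2 / 4) * std_normal_density x) (sqrt 2)"
proof -
  have "has_bochner_integral lborel (\<lambda>x. sqrt 2 * normal_density 0 (sqrt 2) x) (sqrt 2 * 1)"
    by (intro has_bochner_integral_mult_right) (simp add: has_bochner_integral_iff integrable_normal_density integral_normal_density)
  also have "(\<lambda>x. sqrt 2 * normal_density 0 (sqrt 2) x) = (\<lambda>x. exp (x\<^sup>2 / 4) * std_normal_density x)"
  proof
    fix x :: real
    have "exp (- x\<^sup>2 / 4) = exp (x\<^sup>2 / 4) * exp (- x\<^sup>2 / 2)"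
      by (simp flip: exp_add)
    thus "sqrt 2 * normal_density 0 (sqrt 2) x = exp (x\<^sup>2 / 4) * std_normal_density x"
      by (simp add: normal_density_def real_sqrt_mult field_simps)
  qed
  finally show ?thesis by simp
qed

text \<open>Hubbard--Stratonovich: \<open>exp (z\<^sup>2 / 4)\<close> is a Gaussian average of exponentials linear in \<open>z\<close>, so a
  bound on the linear moment generating function controls the quadratic one, one coordinate at a time.\<close>

lemma subgaussian_square:
  fixes z :: "'r \<Rightarrow> 'w \<Rightarrow> real" and W :: "'w \<Rightarrow> real"
  assumes "finite R" "finite \<Omega>"
    and "\<And>h. (\<Sum>\<omega>\<in>\<Omega>. W \<omega> * exp (\<Sum>r\<in>R. h r * z r \<omega>)) \<le> N * exp ((\<Sum>r\<in>R. (h r)\<^sup>2) / 2)"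
  shows "(\<Sum>\<omega>\<in>\<Omega>. W \<omega> * exp ((\<Sum>r\<in>R. (z r \<omega>)\<^sup>2) / 4)) \<le> N * sqrt 2 ^ card R"
  using assms(1,3)
proof (induction R arbitrary: W N)
  case empty
  from empty[of "\<lambda>_. 0"] show ?case by simp
next
  case (insert r R)
  \<comment> \<open>The induction hypothesis is used with the quadratic factor of \<open>r\<close>
    absorbed into the weight and a factor \<open>sqrt 2\<close> into the constant; hence both are
    generalised.\<close>
  have "(\<Sum>\<omega>\<in>\<Omega>. (W \<omega> * exp ((z r \<omega>)\<^sup>2 / 4)) * exp ((\<Sum>r\<in>R. (z r \<omega>)\<^sup>2) / 4)) \<le> (N * sqrt 2) * sqrt 2 ^ card R"
  proof (rule insert.IH)
    fix h :: "'r \<Rightarrow> real"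
    let ?L = "\<lambda>x. \<Sum>\<omega>\<in>\<Omega>. W \<omega> * exp (\<Sum>r\<in>R. h r * z r \<omega>) * (exp (x * z r \<omega> / sqrt 2) * std_normal_density x)"
    let ?U = "\<lambda>x. N * exp ((\<Sum>r\<in>R. (h r)\<^sup>2) / 2) * (exp (x\<^sup>2 / 4) * std_normal_density x)"
    have L: "has_bochner_integral lborel ?L (\<Sum>\<omega>\<in>\<Omega>. W \<omega> * exp (\<Sum>r\<in>R. h r * z r \<omega>) * exp ((z r \<omega>)\<^sup>2 / 4))"
      by (intro has_bochner_integral_sum has_bochner_integral_mult_right gaussian_linear_exp)
    have U: "has_bochner_integral lborel ?U (N * exp ((\<Sum>r\<in>R. (h r)\<^sup>2) / 2) * sqrt 2)"
      by (intro has_bochner_integral_mult_right gaussian_square_exp)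
    have LU: "?L x \<le> ?U x" for x
    proof -
      \<comment> \<open>Giving \<open>r\<close> the Gaussian coefficient \<open>x / sqrt 2\<close>
        produces the linear term on the left and adds \<open>x^2 / 2\<close> to the sum of squares.
        Integrating both sides against the normal density over \<open>x\<close> then yields the
        claim.\<close>
      let ?h = "h(r := x / sqrt 2)"
      have hz: "(\<Sum>r'\<in>insert r R. ?h r' * z r' \<omega>) = (\<Sum>r\<in>R. h r * z r \<omega>) + x * z r \<omega> / sqrt 2" for \<omega>
      proof -
        have "(\<Sum>r'\<in>R. ?h r' * z r' \<omega>) = (\<Sum>r\<in>R. h r * z r \<omega>)" using insert.hyps by (intro sum.cong) auto
        thus ?thesis using insert.hyps by simp
      qed
      have hh: "(\<Sum>r'\<in>insert r R. (?h r')\<^sup>2) = (\<Sum>r\<in>R. (h r)\<^sup>2) + x\<^sup>2 / 2"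
      proof -
        have "(\<Sum>r'\<in>R. (?h r')\<^sup>2) = (\<Sum>r\<in>R. (h r)\<^sup>2)" using insert.hyps by (intro sum.cong) auto
        thus ?thesis using insert.hyps by (simp add: power_divide)
      qed
      have "?L x = (\<Sum>\<omega>\<in>\<Omega>. W \<omega> * exp (\<Sum>r'\<in>insert r R. ?h r' * z r' \<omega>)) * std_normal_density x"
        unfolding hz exp_add by (simp only: sum_distrib_right mult.assoc)
      also have "\<dots> \<le> (N * exp ((\<Sum>r'\<in>insert r R. (?h r')\<^sup>2) / 2)) * std_normal_density x"
        by (intro mult_right_mono insert.prems) (simp add: normal_density_nonneg)
      also have "\<dots> = ?U x" unfolding hh by (simp add: add_divide_distrib exp_add mult_ac)
      finally show ?thesis .
    qed
    have "integral\<^sup>L lborel ?L \<le> integral\<^sup>L lborel ?U"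
      by (rule integral_mono[OF integrable.intros[OF L] integrable.intros[OF U] LU])
    hence "(\<Sum>\<omega>\<in>\<Omega>. W \<omega> * exp (\<Sum>r\<in>R. h r * z r \<omega>) * exp ((z r \<omega>)\<^sup>2 / 4)) \<le> N * exp ((\<Sum>r\<in>R. (h r)\<^sup>2) / 2) * sqrt 2"
      unfolding has_bochner_integral_integral_eq[OF L] has_bochner_integral_integral_eq[OF U] .
    thus "(\<Sum>\<omega>\<in>\<Omega>. W \<omega> * exp ((z r \<omega>)\<^sup>2 / 4) * exp (\<Sum>r\<in>R. h r * z r \<omega>)) \<le> N * sqrt 2 * exp ((\<Sum>r\<in>R. (h r)\<^sup>2) / 2)"
      by (simp add: mult_ac)
  qed
  moreover have "exp ((\<Sum>r\<in>insert r R. (z r \<omega>)\<^sup>2) / 4) = exp ((z r \<omega>)\<^sup>2 / 4) * exp ((\<Sum>r\<in>R. (z r \<omega>)\<^sup>2) / 4)" for \<omega>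
    using insert.hyps by (simp add: add_divide_distrib exp_add)
  ultimately show ?case using insert.hyps by (simp add: mult_ac)
qed

text \<open>Round real and imaginary parts down to multiples of \<open>1 / M\<close>: each takes at
  most \<open>2 * M + 1\<close> values, and two functions with the same code differ by at most
  \<open>1 / M\<close> in each part. Representatives are taken from \<open>T\<close> itself, so that
  they keep the exact normalisation on which the moment bound depends.\<close>

lemma grid_net:
  fixes T :: "('i \<Rightarrow> complex) set" and M :: nat
  assumes "finite I" "0 < M" and T: "\<And>f i. f \<in> T \<Longrightarrow> i \<in> I \<Longrightarrow> cmod (f i) \<le> 1"
  obtains C where "finite C" "C \<subseteq> T" "card C \<le> (2 * M + 1) ^ (2 * card I)"
    "\<And>f. f \<in> T \<Longrightarrow> \<exists>g\<in>C. \<forall>i\<in>I. cmod (f i - g i) \<le> 2 / M"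
proof -
  define code where "code f = restrict (\<lambda>i. (\<lfloor>M * Re (f i)\<rfloor>, \<lfloor>M * Im (f i)\<rfloor>)) I" for f :: "'i \<Rightarrow> complex"
  let ?S = "{- int M..int M} \<times> {- int M..int M}"
  have bnd: "\<lfloor>M * x\<rfloor> \<in> {- int M..int M}" if "\<bar>x\<bar> \<le> 1" for x :: real
  proof -
    have "real M * x \<le> real M * 1" using that by (intro mult_left_mono) auto
    moreover have "real M * (-1) \<le> real M * x" using that by (intro mult_left_mono) auto
    ultimately show ?thesis by (auto simp: le_floor_iff floor_le_iff)
  qed
  have img: "code ` T \<subseteq> PiE I (\<lambda>_. ?S)"
  proof
    fix c assume "c \<in> code ` T"
    then obtain f where f: "f \<in> T" "c = code f" by blast
    have "\<bar>Re (f i)\<bar> \<le> 1" "\<bar>Im (f i)\<bar> \<le> 1" if "i \<in> I" for i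
      using T[OF f(1) that] abs_Re_le_cmod[of "f i"] abs_Im_le_cmod[of "f i"] by linarith+
    thus "c \<in> PiE I (\<lambda>_. ?S)" using bnd unfolding f code_def by auto
  qed
  have fin: "finite (PiE I (\<lambda>_. ?S))" using assms(1) by (intro finite_PiE) auto
  have "card (code ` T) \<le> card (PiE I (\<lambda>_. ?S))" using img fin by (intro card_mono)
  also have "\<dots> = ((2 * M + 1) * (2 * M + 1)) ^ card I"
  proof -
    have "card {- int M..int M} = nat (int M - - int M + 1)" by simp
    also have "\<dots> = 2 * M + 1" by arith
    finally show ?thesis using assms(1) by (simp only: card_PiE card_cartesian_product prod_constant)
  qed
  also have "\<dots> = (2 * M + 1) ^ (2 * card I)" by (simp add: power_mult power2_eq_square)
  finally have card: "card (code ` T) \<le> (2 * M + 1) ^ (2 * card I)" .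
  \<comment> \<open>One member of \<open>T\<close> for each code that occurs.\<close>
  define C where "C = inv_into T code ` code ` T"
  show ?thesis
  proof (rule that[of C])
    have finc: "finite (code ` T)" using img fin by (rule finite_subset)
    show "finite C" using finc by (simp add: C_def)
    show "C \<subseteq> T" by (auto simp: C_def intro: inv_into_into)
    show "card C \<le> (2 * M + 1) ^ (2 * card I)" unfolding C_def using card_image_le[OF finc] card by (rule order_trans)
    fix f assume f: "f \<in> T"
    define g where "g = inv_into T code (code f)"
    have g: "g \<in> C" "code g = code f" using f by (auto simp: C_def g_def f_inv_into_f)
    have close: "\<bar>x - y\<bar> \<le> 1 / M" if "\<lfloor>M * x\<rfloor> = \<lfloor>M * y\<rfloor>" for x y :: real
    proof -
      have "\<bar>M * x - M * y\<bar> \<le> 1" using that by linarith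
      hence "M * \<bar>x - y\<bar> \<le> 1" by (simp add: abs_mult flip: right_diff_distrib)
      thus ?thesis using assms(2) by (simp add: field_simps)
    qed
    have "cmod (f i - g i) \<le> 2 / M" if "i \<in> I" for i
    proof -
      have "\<lfloor>M * Re (f i)\<rfloor> = \<lfloor>M * Re (g i)\<rfloor>" "\<lfloor>M * Im (f i)\<rfloor> = \<lfloor>M * Im (g i)\<rfloor>"
        using fun_cong[OF g(2), of i] that by (auto simp: code_def)
      from close[OF this(1)] close[OF this(2)] show ?thesis using cmod_le[of "f i - g i"] by simp
    qed
    thus "\<exists>g\<in>C. \<forall>i\<in>I. cmod (f i - g i) \<le> 2 / M" using g(1) by blast
  qed
qed


section \<open>Exponential moments of the energy on a frame, and the union bound\<close>

lemma orthonormal_comb_norm: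
  assumes "orthonormal k d q"
  shows "(\<Sum>i<d. (cmod (\<Sum>l<k. c l * cnj (q l i)))\<^sup>2) = (\<Sum>l<k. (cmod (c l))\<^sup>2)"
proof -
  have "complex_of_real (\<Sum>i<d. (cmod (\<Sum>l<k. c l * cnj (q l i)))\<^sup>2)
     = (\<Sum>i<d. \<Sum>l<k. \<Sum>m<k. (c l * cnj (c m)) * (cnj (q l i) * q m i))"
    by (simp only: of_real_sum complex_norm_square) (simp add: sum_product mult_ac)
  also have "\<dots> = (\<Sum>l<k. \<Sum>m<k. (c l * cnj (c m)) * (\<Sum>i<d. cnj (q l i) * q m i))"
    unfolding sum_distrib_left by (rule sum_swap3)
  also have "\<dots> = (\<Sum>l<k. \<Sum>m<k. if m = l then c l * cnj (c l) else 0)"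
  proof (intro sum.cong refl)
    fix l m assume "l \<in> {..<k}" "m \<in> {..<k}"
    hence "(\<Sum>i<d. cnj (q l i) * q m i) = (if l = m then 1 else 0)"
      using assms unfolding orthonormal_def by blast
    thus "(c l * cnj (c m)) * (\<Sum>i<d. cnj (q l i) * q m i) = (if m = l then c l * cnj (c l) else 0)" by simp
  qed
  also have "\<dots> = complex_of_real (\<Sum>l<k. (cmod (c l))\<^sup>2)"
    by (simp only: of_real_sum complex_norm_square) simp
  finally show ?thesis unfolding of_real_eq_iff .
qed

text \<open>The sum from \<open>frame_bound\<close> with the raw sign tensor in place of an
  isometry. For a unit input and an orthonormal frame its average over all signs is
  \<open>k * e\<close>, the scale of the bounds below.\<close>

definition frame_energy :: "nat \<Rightarrow> nat \<Rightarrow> nat \<Rightarrow> nat \<Rightarrow> (nat \<times> nat \<times> nat \<Rightarrow> real) \<Rightarrow> (nat \<Rightarrow> nat \<Rightarrow> complex) \<Rightarrow> (nat \<Rightarrow> complex) \<Rightarrow> real" where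
  "frame_energy d n e k G q a =
     (\<Sum>l<k. \<Sum>\<kappa><e. (cmod (\<Sum>i<d. cnj (q l i) * (\<Sum>j<n. of_real (G (i,\<kappa>,j)) * a j)))\<^sup>2)"

definition sign_tensors :: "nat \<Rightarrow> nat \<Rightarrow> nat \<Rightarrow> (nat \<times> nat \<times> nat \<Rightarrow> real) set" where
  "sign_tensors d n e = PiE ({..<d} \<times> {..<e} \<times> {..<n}) (\<lambda>_. {1,-1})"

lemma finite_sign_tensors: "finite (sign_tensors d n e)"
  unfolding sign_tensors_def by (intro finite_PiE) auto

lemma card_sign_tensors: "card (sign_tensors d n e) = 2 ^ (d * e * n)"
  unfolding sign_tensors_def by (simp add: card_PiE card_cartesian_product mult.assoc numeral_2_eq_2)

text \<open>The energy is a sum of squares of \<open>2 * k * e\<close> real linear forms in the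
  signs. A combination of these forms with coefficients \<open>h\<close> is again linear in the
  signs, and by Pythagoras its squared coefficients sum to at most those of \<open>h\<close>. So
  \<open>rademacher_mgf\<close> provides the hypothesis of \<open>subgaussian_square\<close>, and
  each form costs a factor \<open>sqrt 2\<close>.\<close>

lemma mgf_frame_energy:
  assumes a: "(\<Sum>j<n. (cmod (a j))\<^sup>2) = 1" and q: "orthonormal k d q"
  shows "(\<Sum>\<omega>\<in>sign_tensors d n e. exp (frame_energy d n e k \<omega> q a / 4)) \<le> 2 ^ (d * e * n) * 2 ^ (k * e)"
proof -
  let ?X = "{..<d} \<times> {..<e} \<times> {..<n}"
  define R where "R = ({..<k} \<times> {..<e}) \<times> (UNIV :: bool set)"
  define Z where "Z l \<kappa> \<omega> = (\<Sum>i<d. cnj (q l i) * (\<Sum>j<n. of_real (\<omega> (i,\<kappa>,j)) * a j))" for l \<kappa> and \<omega> :: "nat \<times> nat \<times> nat \<Rightarrow> real"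
  define z where "z r \<omega> = (case r of ((l,\<kappa>),b) \<Rightarrow> if b then Re (Z l \<kappa> \<omega>) else Im (Z l \<kappa> \<omega>))" for r \<omega>
  have sumR: "(\<Sum>r\<in>R. f r) = (\<Sum>l<k. \<Sum>\<kappa><e. f ((l,\<kappa>),True) + f ((l,\<kappa>),False))" for f :: "(nat \<times> nat) \<times> bool \<Rightarrow> real"
    unfolding R_def sum.cartesian_product[symmetric, of _ "{..<k} \<times> {..<e}"] 
    by (simp add: sum.cartesian_product' UNIV_bool add.commute)
  have sumX: "(\<Sum>x\<in>?X. f x) = (\<Sum>i<d. \<Sum>\<kappa><e. \<Sum>j<n. f (i,\<kappa>,j))" for f :: "nat \<times> nat \<times> nat \<Rightarrow> real"
    by (simp add: sum.cartesian_product')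
  have energy: "(\<Sum>r\<in>R. (z r \<omega>)\<^sup>2) = frame_energy d n e k \<omega> q a" for \<omega>
    unfolding sumR by (simp add: z_def frame_energy_def Z_def cmod_power2)
  have "(\<Sum>\<omega>\<in>sign_tensors d n e. 1 * exp ((\<Sum>r\<in>R. (z r \<omega>)\<^sup>2) / 4)) \<le> 2 ^ (d * e * n) * sqrt 2 ^ card R"
  proof (rule subgaussian_square)
    show "finite R" by (simp add: R_def)
    show "finite (sign_tensors d n e)" by (rule finite_sign_tensors)
    fix h :: "(nat \<times> nat) \<times> bool \<Rightarrow> real"
    \<comment> \<open>The minus sign makes the real part of
      \<open>H l \<kappa> * Z l \<kappa> \<omega>\<close> equal to the wanted combination of real
      and imaginary part.\<close>
    define H where "H l \<kappa> = Complex (h ((l,\<kappa>),True)) (- h ((l,\<kappa>),False))" for l \<kappa>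
    define w where "w i \<kappa> = (\<Sum>l<k. H l \<kappa> * cnj (q l i))" for i \<kappa>
    define c where "c x = (case x of (i,\<kappa>,j) \<Rightarrow> Re (w i \<kappa> * a j))" for x
    have lin: "(\<Sum>r\<in>R. h r * z r \<omega>) = (\<Sum>x\<in>?X. \<omega> x * c x)" for \<omega>
    proof -
      have "(\<Sum>r\<in>R. h r * z r \<omega>) = Re (\<Sum>l<k. \<Sum>\<kappa><e. H l \<kappa> * Z l \<kappa> \<omega>)"
        unfolding sumR by (simp add: z_def H_def)
      also have "(\<Sum>l<k. \<Sum>\<kappa><e. H l \<kappa> * Z l \<kappa> \<omega>) = (\<Sum>l<k. \<Sum>\<kappa><e. \<Sum>i<d. (H l \<kappa> * cnj (q l i)) * (\<Sum>j<n. of_real (\<omega> (i,\<kappa>,j)) * a j))"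
        by (simp only: Z_def sum_distrib_left mult.assoc)
      also have "\<dots> = (\<Sum>\<kappa><e. \<Sum>i<d. \<Sum>l<k. (H l \<kappa> * cnj (q l i)) * (\<Sum>j<n. of_real (\<omega> (i,\<kappa>,j)) * a j))"
        by (rule sum_swap3)
      also have "\<dots> = (\<Sum>\<kappa><e. \<Sum>i<d. w i \<kappa> * (\<Sum>j<n. of_real (\<omega> (i,\<kappa>,j)) * a j))"
        by (simp only: w_def sum_distrib_right)
      also have "\<dots> = (\<Sum>i<d. \<Sum>\<kappa><e. w i \<kappa> * (\<Sum>j<n. of_real (\<omega> (i,\<kappa>,j)) * a j))"
        by (rule sum.swap)
      also have "\<dots> = (\<Sum>i<d. \<Sum>\<kappa><e. \<Sum>j<n. of_real (\<omega> (i,\<kappa>,j)) * (w i \<kappa> * a j))"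
        by (simp only: sum_distrib_left mult.left_commute)
      also have "Re \<dots> = (\<Sum>x\<in>?X. \<omega> x * c x)"
        unfolding sumX by (simp only: Re_sum Re_complex_of_real Im_complex_of_real times_complex.sel) (simp add: c_def)
      finally show ?thesis .
    qed
    have "(\<Sum>x\<in>?X. (c x)\<^sup>2) \<le> (\<Sum>i<d. \<Sum>\<kappa><e. \<Sum>j<n. (cmod (w i \<kappa>))\<^sup>2 * (cmod (a j))\<^sup>2)"
      unfolding sumX
    proof (intro sum_mono)
      fix i \<kappa> j
      have "\<bar>c (i,\<kappa>,j)\<bar> \<le> cmod (w i \<kappa> * a j)" unfolding c_def prod.case by (rule abs_Re_le_cmod)
      hence "(c (i,\<kappa>,j))\<^sup>2 \<le> (cmod (w i \<kappa> * a j))\<^sup>2" by (metis abs_le_square_iff abs_norm_cancel)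
      thus "(c (i,\<kappa>,j))\<^sup>2 \<le> (cmod (w i \<kappa>))\<^sup>2 * (cmod (a j))\<^sup>2" by (simp add: norm_mult power_mult_distrib)
    qed
    also have "\<dots> = (\<Sum>i<d. \<Sum>\<kappa><e. (cmod (w i \<kappa>))\<^sup>2)" by (simp add: a flip: sum_distrib_left)
    also have "\<dots> = (\<Sum>\<kappa><e. \<Sum>i<d. (cmod (w i \<kappa>))\<^sup>2)" by (rule sum.swap)
    also have "\<dots> = (\<Sum>\<kappa><e. \<Sum>l<k. (cmod (H l \<kappa>))\<^sup>2)" unfolding w_def by (simp only: orthonormal_comb_norm[OF q])
    also have "\<dots> = (\<Sum>l<k. \<Sum>\<kappa><e. (cmod (H l \<kappa>))\<^sup>2)" by (rule sum.swap)
    also have "\<dots> = (\<Sum>r\<in>R. (h r)\<^sup>2)" unfolding sumR by (simp add: H_def cmod_power2)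
    finally have c: "(\<Sum>x\<in>?X. (c x)\<^sup>2) \<le> (\<Sum>r\<in>R. (h r)\<^sup>2)" .
    have "(\<Sum>\<omega>\<in>sign_tensors d n e. 1 * exp (\<Sum>r\<in>R. h r * z r \<omega>)) \<le> 2 ^ card ?X * exp ((\<Sum>x\<in>?X. (c x)\<^sup>2) / 2)"
      unfolding lin sign_tensors_def mult_1 by (rule rademacher_mgf) simp
    also have "\<dots> \<le> 2 ^ (d * e * n) * exp ((\<Sum>r\<in>R. (h r)\<^sup>2) / 2)"
      using c by (simp add: card_cartesian_product mult.assoc)
    finally show "(\<Sum>\<omega>\<in>sign_tensors d n e. 1 * exp (\<Sum>r\<in>R. h r * z r \<omega>)) \<le> 2 ^ (d * e * n) * exp ((\<Sum>r\<in>R. (h r)\<^sup>2) / 2)" .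
  qed
  moreover have "sqrt 2 ^ card R = 2 ^ (k * e)"
    by (simp add: R_def card_cartesian_product power_mult mult.commute[of _ 2])
  ultimately show ?thesis unfolding energy by simp
qed

lemma orthonormal_le_1:
  assumes "orthonormal k d q" "l < k" "i < d"
  shows "cmod (q l i) \<le> 1"
proof -
  have "(\<Sum>i<d. cnj (q l i) * q l i) = 1"
    using assms(1)[unfolded orthonormal_def, rule_format, OF assms(2) assms(2)] by (simp only: if_True simp_thms)
  hence "complex_of_real (\<Sum>i<d. (cmod (q l i))\<^sup>2) = of_real 1"
    by (simp only: of_real_sum complex_norm_square mult.commute) simp
  hence "(\<Sum>i<d. (cmod (q l i))\<^sup>2) = 1" unfolding of_real_eq_iff .
  hence "(cmod (q l i))\<^sup>2 \<le> 1" using member_le_sum[of i "{..<d}" "\<lambda>i. (cmod (q l i))\<^sup>2"] assms(3) by simp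
  thus ?thesis by (simp add: power_le_one_iff)
qed

text \<open>Both bilinear forms have modulus at most \<open>d * n\<close>, and they differ by at
  most \<open>2 * d * n * \<delta>\<close>. Factor the difference of squares as sum times
  difference.\<close>

lemma bilinear_square_perturb:
  fixes q q' a a' :: "nat \<Rightarrow> complex" and g :: "nat \<Rightarrow> nat \<Rightarrow> real"
  assumes g: "\<And>i j. i < d \<Longrightarrow> j < n \<Longrightarrow> \<bar>g i j\<bar> \<le> 1"
    and q: "\<And>i. i < d \<Longrightarrow> cmod (q i) \<le> 1" "\<And>i. i < d \<Longrightarrow> cmod (q' i) \<le> 1" "\<And>i. i < d \<Longrightarrow> cmod (q i - q' i) \<le> \<delta>"
    and a: "\<And>j. j < n \<Longrightarrow> cmod (a j) \<le> 1" "\<And>j. j < n \<Longrightarrow> cmod (a' j) \<le> 1" "\<And>j. j < n \<Longrightarrow> cmod (a j - a' j) \<le> \<delta>"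
  shows "(cmod (\<Sum>i<d. cnj (q i) * (\<Sum>j<n. of_real (g i j) * a j)))\<^sup>2
    \<le> (cmod (\<Sum>i<d. cnj (q' i) * (\<Sum>j<n. of_real (g i j) * a' j)))\<^sup>2 + 4 * (real d * real n)\<^sup>2 * \<delta>"
proof -
  define Z where "Z q a = (\<Sum>i<d. \<Sum>j<n. of_real (g i j) * (cnj (q i) * a j))" for q a :: "nat \<Rightarrow> complex"
  have Z: "(\<Sum>i<d. cnj (q i) * (\<Sum>j<n. of_real (g i j) * a j)) = Z q a" for q a
    by (simp add: Z_def sum_distrib_left mult_ac)
  have bound: "cmod (\<Sum>i<d. \<Sum>j<n. of_real (g i j) * h i j) \<le> real d * real n * b"
    if h: "\<And>i j. i < d \<Longrightarrow> j < n \<Longrightarrow> cmod (h i j) \<le> b" for h b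
  proof -
    have "cmod (\<Sum>i<d. \<Sum>j<n. of_real (g i j) * h i j) \<le> (\<Sum>i<d. \<Sum>j<n. cmod (of_real (g i j) * h i j))"
      by (intro sum_norm_le norm_sum)
    also have "\<dots> \<le> (\<Sum>i<d. \<Sum>j<n. b)"
    proof (intro sum_mono)
      fix i j assume "i \<in> {..<d}" "j \<in> {..<n}"
      hence "\<bar>g i j\<bar> * cmod (h i j) \<le> 1 * b" using g h by (intro mult_mono) auto
      thus "cmod (of_real (g i j) * h i j) \<le> b" by (simp add: norm_mult)
    qed
    also have "\<dots> = real d * real n * b" by simp
    finally show ?thesis .
  qed
  have 1: "cmod (Z q a) \<le> real d * real n * 1" unfolding Z_def
    by (rule bound) (use q a in \<open>auto simp: norm_mult intro!: mult_le_one\<close>)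
  have 2: "cmod (Z q' a') \<le> real d * real n * 1" unfolding Z_def
    by (rule bound) (use q a in \<open>auto simp: norm_mult intro!: mult_le_one\<close>)
  have "Z q a - Z q' a' = (\<Sum>i<d. \<Sum>j<n. of_real (g i j) * (cnj (q i) * a j - cnj (q' i) * a' j))"
    unfolding Z_def by (simp add: sum_subtractf right_diff_distrib)
  also have "cmod \<dots> \<le> real d * real n * (2 * \<delta>)"
  proof (rule bound)
    fix i j assume ij: "i < d" "j < n"
    have "cnj (q i) * a j - cnj (q' i) * a' j = cnj (q i - q' i) * a j + cnj (q' i) * (a j - a' j)"
      by (simp add: algebra_simps)
    also have "cmod \<dots> \<le> cmod (q i - q' i) * cmod (a j) + cmod (q' i) * cmod (a j - a' j)"
      by (rule order_trans[OF norm_triangle_ineq]) (simp only: norm_mult complex_mod_cnj order_refl)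
    also have "\<dots> \<le> \<delta> * 1 + 1 * \<delta>"
      using q a ij order_trans[OF norm_ge_zero q(3)[OF ij(1)]] by (intro add_mono mult_mono) auto
    finally show "cmod (cnj (q i) * a j - cnj (q' i) * a' j) \<le> 2 * \<delta>" by simp
  qed
  finally have 3: "cmod (Z q a - Z q' a') \<le> real d * real n * (2 * \<delta>)" .
  have tri: "cmod (Z q a) - cmod (Z q' a') \<le> real d * real n * (2 * \<delta>)"
    using norm_triangle_ineq2[of "Z q a" "Z q' a'"] 3 by linarith
  have 4: "(cmod (Z q a))\<^sup>2 - (cmod (Z q' a'))\<^sup>2 = (cmod (Z q a) + cmod (Z q' a')) * (cmod (Z q a) - cmod (Z q' a'))"
    by (simp add: power2_eq_square algebra_simps)
  also have "\<dots> \<le> (cmod (Z q a) + cmod (Z q' a')) * (real d * real n * (2 * \<delta>))"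
    using tri by (intro mult_left_mono) auto
  also have "\<dots> \<le> (2 * (real d * real n)) * (real d * real n * (2 * \<delta>))"
  proof (rule mult_right_mono)
    show "0 \<le> real d * real n * (2 * \<delta>)" using 3 norm_ge_zero order_trans by blast
  qed (use 1 2 in linarith)
  also have "\<dots> = 4 * (real d * real n)\<^sup>2 * \<delta>" by (simp add: power2_eq_square)
  finally show ?thesis unfolding Z by simp
qed

text \<open>A union bound by averaging over a net of pairs (input, frame). The assumption makes the
  logarithm of the size of the net small against \<open>k * e\<close>, so some tensor is good on the
  whole net; the perturbation estimate extends this to all inputs and frames.\<close>

lemma exists_sign_tensor:
  assumes pos: "0 < n" "0 < d"
    and H: "8 * (real n + real k * real d) * ln (160 * (real d * real n)\<^sup>2 + 1) \<le> real k * real e / 10"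
  obtains G where "G \<in> sign_tensors d n e"
    "\<And>a q. (\<Sum>j<n. (cmod (a j))\<^sup>2) = 1 \<Longrightarrow> orthonormal k d q \<Longrightarrow> frame_energy d n e k G q a \<le> 3 * (real k * real e)"
proof -
  \<comment> \<open>Input and frame are packed into one function, \<open>Inl\<close> for the input
    and \<open>Inr\<close> for the frame, so that one net serves both.\<close>
  define T where "T = {f :: nat + nat \<times> nat \<Rightarrow> complex. (\<Sum>j<n. (cmod (f (Inl j)))\<^sup>2) = 1 \<and> orthonormal k d (\<lambda>l i. f (Inr (l,i)))}"
  define I :: "(nat + nat \<times> nat) set" where "I = {..<n} <+> ({..<k} \<times> {..<d})"
  define Y where "Y = (real n + real k * real d) * ln (160 * (real d * real n)\<^sup>2 + 1)"
  have HY: "8 * Y \<le> real k * real e / 10" using H by (simp only: Y_def mult.assoc)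
  define M where "M = 80 * (d * n)\<^sup>2"
  have M: "0 < M" using pos by (simp add: M_def)
  have cardI: "card I = n + k * d" by (simp add: I_def card_Plus card_cartesian_product)
  have T1: "cmod (f i) \<le> 1" if "f \<in> T" "i \<in> I" for f i
  proof -
    consider j where "i = Inl j" "j < n" | l m where "i = Inr (l,m)" "l < k" "m < d"
      using \<open>i \<in> I\<close> by (auto simp: I_def)
    thus ?thesis
    proof cases
      case 1
      have "(cmod (f (Inl j)))\<^sup>2 \<le> 1"
        using member_le_sum[of j "{..<n}" "\<lambda>j. (cmod (f (Inl j)))\<^sup>2"] that(1) 1 by (simp add: T_def)
      thus ?thesis using 1 by (simp add: power_le_one_iff)
    next
      case 2
      thus ?thesis using that(1) orthonormal_le_1[of k d "\<lambda>l i. f (Inr (l,i))" l m] by (simp add: T_def)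
    qed
  qed
  obtain C where C: "finite C" "C \<subseteq> T" "card C \<le> (2 * M + 1) ^ (2 * card I)"
    "\<And>f. f \<in> T \<Longrightarrow> \<exists>g\<in>C. \<forall>i\<in>I. cmod (f i - g i) \<le> 2 / M"
    using grid_net[of I M T] M T1 unfolding I_def by (metis finite_Plus finite_SigmaI finite_lessThan)
  define E where "E G f = frame_energy d n e k G (\<lambda>l i. f (Inr (l,i))) (\<lambda>j. f (Inl j))" for G and f :: "nat + nat \<times> nat \<Rightarrow> complex"
  let ?S = "sign_tensors d n e"
  \<comment> \<open>Otherwise every tensor violates the bound at some net point, and the
    exponentials summed over tensors and net exceed the total allowed by
    \<open>mgf_frame_energy\<close>.\<close>
  have "\<exists>G\<in>?S. \<forall>g\<in>C. exp (E G g / 4) \<le> real (card C) * 2 ^ (k * e)"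
  proof (rule ccontr)
    assume neg: "\<not> ?thesis"
    have "(\<Sum>G\<in>?S. real (card C) * 2 ^ (k * e)) < (\<Sum>G\<in>?S. \<Sum>g\<in>C. exp (E G g / 4))"
    proof (rule sum_strict_mono)
      show "?S \<noteq> {}" using card_sign_tensors[of d n e] by (metis card.empty power_not_zero zero_neq_numeral)
      fix G assume "G \<in> ?S"
      then obtain g where g: "g \<in> C" "real (card C) * 2 ^ (k * e) < exp (E G g / 4)" using neg by (meson not_le)
      note g(2)
      also have "exp (E G g / 4) \<le> (\<Sum>g\<in>C. exp (E G g / 4))" using g(1) C(1) by (intro member_le_sum) auto
      finally show "real (card C) * 2 ^ (k * e) < (\<Sum>g\<in>C. exp (E G g / 4))" .
    qed (rule finite_sign_tensors)
    also have "\<dots> = (\<Sum>g\<in>C. \<Sum>G\<in>?S. exp (E G g / 4))" by (rule sum.swap)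
    also have "\<dots> \<le> (\<Sum>g\<in>C. 2 ^ (d * e * n) * 2 ^ (k * e))"
    proof (rule sum_mono)
      fix g assume "g \<in> C"
      hence "g \<in> T" using C by blast
      thus "(\<Sum>G\<in>?S. exp (E G g / 4)) \<le> 2 ^ (d * e * n) * 2 ^ (k * e)"
        unfolding E_def T_def by (intro mgf_frame_energy) auto
    qed
    also have "\<dots> = (\<Sum>G\<in>?S. real (card C) * 2 ^ (k * e))" by (simp add: card_sign_tensors)
    finally show False by simp
  qed
  then obtain G where G: "G \<in> ?S" and GE: "\<And>g. g \<in> C \<Longrightarrow> exp (E G g / 4) \<le> real (card C) * 2 ^ (k * e)" by blast
  have g1: "\<bar>G (i,\<kappa>,j)\<bar> \<le> 1" if "i < d" "\<kappa> < e" "j < n" for i \<kappa> j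
  proof -
    have "G (i,\<kappa>,j) \<in> {1,-1}" using G that unfolding sign_tensors_def by (intro PiE_mem[of G]) auto
    thus ?thesis by auto
  qed
  show ?thesis
  proof (rule that[OF G])
    fix a q assume a: "(\<Sum>j<n. (cmod (a j))\<^sup>2) = 1" and q: "orthonormal k d q"
    define f where "f x = (case x of Inl j \<Rightarrow> a j | Inr (l,i) \<Rightarrow> q l i)" for x
    have f: "f \<in> T" using a q by (simp add: T_def f_def)
    then obtain g where g: "g \<in> C" "\<And>i. i \<in> I \<Longrightarrow> cmod (f i - g i) \<le> 2 / M" using C(4) by blast
    have gT: "g \<in> T" using g C by blast
    have cpos: "0 < card C" using g C by (auto simp: card_gt_0_iff)
    have "exp (E G g / 4) \<le> real ((2 * M + 1) ^ (2 * card I)) * 2 ^ (k * e)"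
      using order_trans[OF GE[OF g(1)] mult_right_mono] C(3) by (metis of_nat_le_iff zero_le_numeral zero_le_power)
    hence "ln (exp (E G g / 4)) \<le> ln (real (2 * M + 1) ^ (2 * card I) * 2 ^ (k * e))"
      by (subst ln_le_cancel_iff) auto
    also have "\<dots> = 2 * Y + real k * real e * ln 2"
    proof -
      have "real (2 * M + 1) = 160 * (real d * real n)\<^sup>2 + 1" by (simp add: M_def)
      moreover have "0 < 160 * (real d * real n)\<^sup>2 + 1" by (simp add: add_nonneg_pos)
      ultimately show ?thesis by (simp add: ln_mult ln_realpow cardI del: of_nat_add of_nat_mult) (simp add: Y_def algebra_simps)
    qed
    also have "real k * real e * ln 2 \<le> real k * real e * (7/10)"
      using ln2_le_25_over_36 by (intro mult_left_mono) auto
    finally have "E G g / 4 \<le> 2 * Y + real k * real e * (7/10)" by (simp only: ln_exp)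
    \<comment> \<open>Multiplying by 4 gives \<open>8 * Y\<close>, at most a tenth of
      \<open>k * e\<close>, plus 28/10 of it. The last tenth up to 3 is left for the grid
      error.\<close>
    hence Eg: "E G g \<le> 29/10 * (real k * real e)" using HY by linarith
    have "frame_energy d n e k G q a = E G f" by (simp add: E_def f_def)
    also have "\<dots> \<le> (\<Sum>l<k. \<Sum>\<kappa><e. (cmod (\<Sum>i<d. cnj (g (Inr (l,i))) * (\<Sum>j<n. of_real (G (i,\<kappa>,j)) * g (Inl j))))\<^sup>2
         + 4 * (real d * real n)\<^sup>2 * (2 / M))"
      unfolding E_def frame_energy_def
    proof (intro sum_mono bilinear_square_perturb)
      fix l \<kappa> i j assume "l \<in> {..<k}" "\<kappa> \<in> {..<e}"
      hence lk: "l < k" "\<kappa> < e" by auto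
      {
        assume i: "i < d"
        hence I: "Inr (l,i) \<in> I" using lk by (auto simp: I_def)
        show "cmod (f (Inr (l,i))) \<le> 1" "cmod (g (Inr (l,i))) \<le> 1" "cmod (f (Inr (l,i)) - g (Inr (l,i))) \<le> 2 / real M"
          using T1[OF f I] T1[OF gT I] g(2)[OF I] by auto
        assume "j < n"
        thus "\<bar>G (i,\<kappa>,j)\<bar> \<le> 1" using g1 i lk by blast
      }
      assume "j < n"
      hence I: "Inl j \<in> I" by (auto simp: I_def)
      show "cmod (f (Inl j)) \<le> 1" "cmod (g (Inl j)) \<le> 1" "cmod (f (Inl j) - g (Inl j)) \<le> 2 / real M"
        using T1[OF f I] T1[OF gT I] g(2)[OF I] by auto
    qed
    also have "\<dots> = E G g + real k * real e * (4 * (real d * real n)\<^sup>2 * (2 / M))"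
      by (simp add: E_def frame_energy_def sum.distrib)
    also have "4 * (real d * real n)\<^sup>2 * (2 / M) = 1 / 10"
      using pos by (simp add: M_def)
    finally show "frame_energy d n e k G q a \<le> 3 * (real k * real e)" using Eg by simp
  qed
qed

section \<open>From sign tensors to isometries\<close>

lemma mod_add_left_inj:
  fixes c l l' d :: nat
  assumes "l < d" "l' < d" "(c + l) mod d = (c + l') mod d"
  shows "l = l'"
proof -
  have *: "a = b" if "a \<le> b" "b < d" "(c + b) mod d = (c + a) mod d" for a b
  proof -
    have "d dvd (c + b) - (c + a)" using that mod_eq_dvd_iff_nat[of "c + a" "c + b" d] by simp
    thus ?thesis using that dvd_imp_le[of d "b - a"] by (cases "b = a") auto
  qed
  show ?thesis using *[of l l'] *[of l' l] assms by (cases "l \<le> l'") auto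
qed

lemma sum_mod_shift:
  "(\<Sum>c<d. f ((c + l) mod d)) = (\<Sum>i<d. f i)" for l d :: nat
proof (cases "d = 0")
  case False
  have inj: "inj_on (\<lambda>c. (c + l) mod d) {..<d}"
  proof (rule inj_onI)
    fix x y assume "x \<in> {..<d}" "y \<in> {..<d}" "(x + l) mod d = (y + l) mod d"
    thus "x = y" using mod_add_left_inj[of x d y l] by (simp only: add.commute[of l] lessThan_iff)
  qed
  moreover have "(\<lambda>c. (c + l) mod d) ` {..<d} = {..<d}"
    using False inj by (intro endo_inj_surj) auto
  ultimately have "bij_betw (\<lambda>c. (c + l) mod d) {..<d} {..<d}" by (simp add: bij_betw_def)
  thus ?thesis by (rule sum.reindex_bij_betw)
qed simp

context
  fixes d n e k :: nat and G :: "nat \<times> nat \<times> nat \<Rightarrow> real"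
  assumes pos: "0 < d" "0 < n" "0 < e" "0 < k" and kd: "k \<le> d"
    and G: "G \<in> sign_tensors d n e"
    and en: "\<And>a q. (\<Sum>j<n. (cmod (a j))\<^sup>2) = 1 \<Longrightarrow> orthonormal k d q \<Longrightarrow> frame_energy d n e k G q a \<le> 3 * (real k * real e)"
begin

definition app :: "(nat \<Rightarrow> complex) \<Rightarrow> nat \<Rightarrow> nat \<Rightarrow> complex" where
  "app a i \<kappa> = (\<Sum>j<n. of_real (G (i,\<kappa>,j)) * a j)"

lemma G_square: "i < d \<Longrightarrow> \<kappa> < e \<Longrightarrow> j < n \<Longrightarrow> G (i,\<kappa>,j) * G (i,\<kappa>,j) = 1"
proof -
  assume "i < d" "\<kappa> < e" "j < n"
  hence "G (i,\<kappa>,j) \<in> {1,-1}" using G unfolding sign_tensors_def by (intro PiE_mem[of G]) auto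
  thus ?thesis by auto
qed

text \<open>Averaging the frame bound over all cyclic windows of \<open>k\<close> basis vectors bounds the full norm.\<close>

lemma app_norm_le:
  assumes a: "(\<Sum>j<n. (cmod (a j))\<^sup>2) = 1"
  shows "(\<Sum>i<d. \<Sum>\<kappa><e. (cmod (app a i \<kappa>))\<^sup>2) \<le> 3 * (real d * real e)"
proof -
  define f where "f i = (\<Sum>\<kappa><e. (cmod (app a i \<kappa>))\<^sup>2)" for i
  have w: "(\<Sum>l<k. f ((c + l) mod d)) \<le> 3 * (real k * real e)" for c
  proof -
    \<comment> \<open>The frame of standard basis vectors numbered \<open>c\<close>, ...,
      \<open>c + k - 1\<close> modulo \<open>d\<close>; they are distinct because
      \<open>k \<le> d\<close>.\<close>
    define q where "q l i = (if i = (c + l) mod d then 1 else 0 :: complex)" for l i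
    have lt: "(c + l) mod d < d" for l using pos by simp
    have "orthonormal k d q" unfolding orthonormal_def
    proof (intro allI impI)
      fix l l' assume l: "l < k" "l' < k"
      have "(\<Sum>i<d. cnj (q l i) * q l' i) = (\<Sum>i<d. if i = (c + l) mod d then q l' i else 0)"
        by (intro sum.cong) (auto simp: q_def)
      also have "\<dots> = q l' ((c + l) mod d)" using lt by simp
      also have "\<dots> = (if l = l' then 1 else 0)"
        using mod_add_left_inj[of l d l' c] l kd by (auto simp: q_def)
      finally show "(\<Sum>i<d. cnj (q l i) * q l' i) = (if l = l' then 1 else 0)" .
    qed
    from en[OF a this] have "frame_energy d n e k G q a \<le> 3 * (real k * real e)" .
    moreover have "frame_energy d n e k G q a = (\<Sum>l<k. f ((c + l) mod d))"
      unfolding frame_energy_def f_def app_def[symmetric]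
    proof (intro sum.cong refl arg_cong[where f = "\<lambda>x. (cmod x)\<^sup>2"])
      fix l \<kappa>
      have "(\<Sum>i<d. cnj (q l i) * app a i \<kappa>) = (\<Sum>i<d. if i = (c + l) mod d then app a i \<kappa> else 0)"
        by (intro sum.cong) (auto simp: q_def)
      thus "(\<Sum>i<d. cnj (q l i) * app a i \<kappa>) = app a ((c + l) mod d) \<kappa>" using lt by simp
    qed
    ultimately show ?thesis by simp
  qed
  \<comment> \<open>Every output index lies in exactly \<open>k\<close> of the \<open>d\<close>
    cyclic windows.\<close>
  have "real k * (\<Sum>i<d. f i) = (\<Sum>l<k. \<Sum>c<d. f ((c + l) mod d))"
    by (simp add: sum_mod_shift)
  also have "\<dots> = (\<Sum>c<d. \<Sum>l<k. f ((c + l) mod d))" by (rule sum.swap)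
  also have "\<dots> \<le> (\<Sum>c<d. 3 * (real k * real e))" by (intro sum_mono w)
  also have "\<dots> = real k * (3 * (real d * real e))" by simp
  finally have "(\<Sum>i<d. f i) \<le> 3 * (real d * real e)" using pos by simp
  thus ?thesis by (simp add: f_def)
qed

text \<open>Homogeneity of degree two extends the bound from unit inputs to arbitrary ones, as
  needed for the rescaled inputs below. The zero vector is treated apart.\<close>

lemma frame_energy_le:
  assumes q: "orthonormal k d q"
  shows "frame_energy d n e k G q a \<le> 3 * (real k * real e) * (\<Sum>j<n. (cmod (a j))\<^sup>2)"
proof -
  define s where "s = (\<Sum>j<n. (cmod (a j))\<^sup>2)"
  have s0: "0 \<le> s" by (simp add: s_def sum_nonneg)
  show ?thesis
  proof (cases "s = 0")
    case True
    hence "\<forall>j<n. a j = 0" by (simp add: s_def sum_nonneg_eq_0_iff)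
    hence "frame_energy d n e k G q a = 0" by (simp add: frame_energy_def)
    thus ?thesis using s0 by (simp add: s_def)
  next
    case False
    hence s: "0 < s" using s0 by simp
    define a' where "a' j = a j / of_real (sqrt s)" for j
    have "(\<Sum>j<n. (cmod (a' j))\<^sup>2) = 1"
      using s by (simp add: a'_def norm_divide power_divide s_def flip: sum_divide_distrib)
    from en[OF this q] have "frame_energy d n e k G q a' \<le> 3 * (real k * real e)" .
    moreover have "frame_energy d n e k G q a' = frame_energy d n e k G q a / s"
    proof -
      have "(\<Sum>i<d. cnj (q l i) * (\<Sum>j<n. of_real (G (i,\<kappa>,j)) * a' j)) =
        (\<Sum>i<d. cnj (q l i) * (\<Sum>j<n. of_real (G (i,\<kappa>,j)) * a j)) / of_real (sqrt s)" for l \<kappa>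
      proof -
        have "(\<Sum>j<n. of_real (G (i,\<kappa>,j)) * a' j) = (\<Sum>j<n. of_real (G (i,\<kappa>,j)) * a j) / of_real (sqrt s)" for i
          by (simp add: a'_def sum_divide_distrib)
        thus ?thesis by (simp only: times_divide_eq_right sum_divide_distrib[symmetric])
      qed
      hence "(cmod (\<Sum>i<d. cnj (q l i) * (\<Sum>j<n. of_real (G (i,\<kappa>,j)) * a' j)))\<^sup>2 =
        (cmod (\<Sum>i<d. cnj (q l i) * (\<Sum>j<n. of_real (G (i,\<kappa>,j)) * a j)))\<^sup>2 / s" for l \<kappa>
        using s by (simp add: norm_divide power_divide)
      thus ?thesis unfolding frame_energy_def by (simp add: sum_divide_distrib)
    qed
    ultimately show ?thesis using s by (simp add: s_def[symmetric] field_simps)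
  qed
qed

text \<open>The Gram matrix \<open>A\<close> of the columns has trace exactly
  \<open>n * d * e\<close>, since signs square to 1, and its eigenvalues are at most
  \<open>3 * d * e\<close> by \<open>app_norm_le\<close>. Hence at least a sixth of them reach half
  the mean \<open>d * e\<close>. The normalised images of those eigenvectors form the isometry;
  undoing the normalisation costs at most \<open>2 / (d * e)\<close> in squared norm and turns
  \<open>3 * k * e\<close> into \<open>6 * k / d\<close>.\<close>

lemma isometry_of_sign_tensor:
  "\<exists>n' V. n \<le> 6 * n' \<and> isometry d n' e V \<and> frame_bound d n' e V k (6 * real k / real d)"
proof -
  define A where "A = mat n n (\<lambda>(j,j'). \<Sum>i<d. \<Sum>\<kappa><e. complex_of_real (G (i,\<kappa>,j) * G (i,\<kappa>,j')))"
  have "hermitian_mat n A" by (auto simp: hermitian_mat_def A_def mult.commute)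
  then obtain u \<mu> where E: "eigensystem n A u \<mu>" and tr: "mat_trace A = of_real (\<Sum>l<n. \<mu> l)"
    by (rule hermitian_eigensystem)
  have ses: "(\<Sum>j<n. \<Sum>j'<n. cnj (v j) * A $$ (j,j') * w j') = (\<Sum>i<d. \<Sum>\<kappa><e. cnj (app v i \<kappa>) * app w i \<kappa>)" for v w
  proof -
    have "(\<Sum>i<d. \<Sum>\<kappa><e. cnj (app v i \<kappa>) * app w i \<kappa>) =
      (\<Sum>i<d. \<Sum>\<kappa><e. \<Sum>j<n. \<Sum>j'<n. cnj (v j) * w j' * of_real (G (i,\<kappa>,j) * G (i,\<kappa>,j')))"
      by (simp only: app_def cnj_sum sum_product) (intro sum.cong refl, simp add: mult_ac)
    also have "\<dots> = (\<Sum>i<d. \<Sum>j<n. \<Sum>j'<n. \<Sum>\<kappa><e. cnj (v j) * w j' * of_real (G (i,\<kappa>,j) * G (i,\<kappa>,j')))"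
      by (rule sum.cong[OF refl], rule sum_swap3)
    also have "\<dots> = (\<Sum>j<n. \<Sum>j'<n. \<Sum>i<d. \<Sum>\<kappa><e. cnj (v j) * w j' * of_real (G (i,\<kappa>,j) * G (i,\<kappa>,j')))"
      by (rule sum_swap3)
    also have "\<dots> = (\<Sum>j<n. \<Sum>j'<n. cnj (v j) * A $$ (j,j') * w j')"
      by (intro sum.cong refl) (simp add: A_def sum_distrib_left sum_distrib_right mult_ac)
    finally show ?thesis ..
  qed
  have app_u: "(\<Sum>i<d. \<Sum>\<kappa><e. cnj (app (u l) i \<kappa>) * app (u l') i \<kappa>) = (if l = l' then of_real (\<mu> l) else 0)"
    if "l < n" "l' < n" for l l'
    unfolding ses[symmetric] by (rule eigensystem_sesquilinear[OF E that])
  have unit: "(\<Sum>j<n. (cmod (u l j))\<^sup>2) = 1" if "l < n" for l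
  proof -
    have "(\<Sum>j<n. cnj (u l j) * u l j) = 1"
      using eigensystemD(1)[OF E, unfolded orthonormal_def, rule_format, OF that that] by (simp only: if_True simp_thms)
    hence "complex_of_real (\<Sum>j<n. (cmod (u l j))\<^sup>2) = of_real 1"
      by (simp only: of_real_sum complex_norm_square mult.commute) simp
    thus ?thesis unfolding of_real_eq_iff .
  qed
  have mu_le: "\<mu> l \<le> 3 * (real d * real e)" if "l < n" for l
  proof -
    have "complex_of_real (\<Sum>i<d. \<Sum>\<kappa><e. (cmod (app (u l) i \<kappa>))\<^sup>2) = of_real (\<mu> l)"
      using app_u[OF that that] by (simp only: of_real_sum complex_norm_square mult.commute if_True simp_thms)
    hence "(\<Sum>i<d. \<Sum>\<kappa><e. (cmod (app (u l) i \<kappa>))\<^sup>2) = \<mu> l" unfolding of_real_eq_iff .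
    thus ?thesis using app_norm_le[OF unit[OF that]] by simp
  qed
  have mu_sum: "(\<Sum>l<n. \<mu> l) = real n * (real d * real e)"
  proof -
    have "mat_trace A = (\<Sum>j<n. \<Sum>i<d. \<Sum>\<kappa><e. complex_of_real (G (i,\<kappa>,j) * G (i,\<kappa>,j)))"
      by (simp add: mat_trace_def A_def)
    also have "\<dots> = (\<Sum>j<n. \<Sum>i<d. \<Sum>\<kappa><e. complex_of_real 1)"
      by (intro sum.cong refl arg_cong[where f = complex_of_real] G_square) auto
    also have "\<dots> = complex_of_real (real n * (real d * real e))" by simp
    finally show ?thesis unfolding tr of_real_eq_iff .
  qed
  \<comment> \<open>Indices outside \<open>L\<close> carry at most half of the trace, and those in
    \<open>L\<close> at most \<open>3 * d * e\<close> each.\<close>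
  define L where "L = {l. l < n \<and> real d * real e / 2 \<le> \<mu> l}"
  have L: "L \<subseteq> {..<n}" "finite L" by (auto simp: L_def)
  define n' where "n' = card L"
  have de: "0 < real d * real e" using pos by simp
  have "n \<le> 6 * n'"
  proof -
    have "real n * (real d * real e) = (\<Sum>l\<in>L. \<mu> l) + (\<Sum>l\<in>{..<n} - L. \<mu> l)"
      unfolding mu_sum[symmetric] using L(1) by (subst sum.subset_diff[of L]) auto
    also have "(\<Sum>l\<in>L. \<mu> l) \<le> (\<Sum>l\<in>L. 3 * (real d * real e))"
      using L by (intro sum_mono mu_le) auto
    also have "(\<Sum>l\<in>{..<n} - L. \<mu> l) \<le> (\<Sum>l\<in>{..<n} - L. real d * real e / 2)"
      by (intro sum_mono) (auto simp: L_def)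
    also have "\<dots> \<le> (\<Sum>l<n. real d * real e / 2)" by (intro sum_mono2) auto
    finally have "real n * (real d * real e) \<le> (3 * real n' + real n / 2) * (real d * real e)"
      by (simp add: n'_def algebra_simps)
    hence "real n \<le> 3 * real n' + real n / 2" using de by (rule mult_right_le_imp_le)
    thus ?thesis by linarith
  qed
  moreover obtain h where h: "bij_betw h {..<n'} L"
    using L(2) unfolding n'_def by (metis finite_lessThan finite_same_card_bij card_lessThan)
  have hn: "h l < n" "real d * real e / 2 \<le> \<mu> (h l)" if "l < n'" for l
    using bij_betwE[OF h] that by (auto simp: L_def)
  have hpos: "0 < \<mu> (h l)" if "l < n'" for l using hn(2)[OF that] de by linarith
  have hinj: "h l = h l' \<longleftrightarrow> l = l'" if "l < n'" "l' < n'" for l l'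
    using h that unfolding bij_betw_def inj_on_def by auto
  define V where "V i \<kappa> l = app (u (h l)) i \<kappa> / of_real (sqrt (\<mu> (h l)))" for i \<kappa> l
  have "isometry d n' e V" unfolding isometry_def
  proof (intro allI impI)
    fix l l' assume l: "l < n'" "l' < n'"
    have "(\<Sum>i<d. \<Sum>\<kappa><e. cnj (V i \<kappa> l) * V i \<kappa> l') =
      (\<Sum>i<d. \<Sum>\<kappa><e. cnj (app (u (h l)) i \<kappa>) * app (u (h l')) i \<kappa>) / of_real (sqrt (\<mu> (h l)) * sqrt (\<mu> (h l')))"
      by (simp add: V_def sum_divide_distrib)
    also have "\<dots> = (if h l = h l' then of_real (\<mu> (h l)) else 0) / of_real (sqrt (\<mu> (h l)) * sqrt (\<mu> (h l')))"
      by (simp only: app_u[OF hn(1)[OF l(1)] hn(1)[OF l(2)]])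
    also have "\<dots> = (if l = l' then 1 else 0)"
      using hpos[OF l(1)] hinj[OF l] by (cases "l = l'") (simp_all flip: of_real_mult)
    finally show "(\<Sum>i<d. \<Sum>\<kappa><e. cnj (V i \<kappa> l) * V i \<kappa> l') = (if l = l' then 1 else 0)" .
  qed
  moreover have "frame_bound d n' e V k (6 * real k / real d)" unfolding frame_bound_def
  proof (intro allI impI)
    fix b q assume b: "(\<Sum>l<n'. (cmod (b l))\<^sup>2) = 1" and q: "orthonormal k d q"
    \<comment> \<open>\<open>a\<close> is the input of the unnormalised tensor whose image is the
      image of \<open>b\<close> under the isometry.\<close>
    define c where "c l = b l / of_real (sqrt (\<mu> (h l)))" for l
    define a where "a j = (\<Sum>l<n'. c l * u (h l) j)" for j
    have on: "orthonormal n' n (\<lambda>l. u (h l))" unfolding orthonormal_def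
    proof (intro allI impI)
      fix l l' assume l: "l < n'" "l' < n'"
      show "(\<Sum>i<n. cnj (u (h l) i) * u (h l') i) = (if l = l' then 1 else 0)"
        using eigensystemD(1)[OF E, unfolded orthonormal_def, rule_format, OF hn(1)[OF l(1)] hn(1)[OF l(2)]] hinj[OF l]
        by (simp only:)
    qed
    have "(\<Sum>j<n. (cmod (a j))\<^sup>2) = (\<Sum>l<n'. (cmod (c l))\<^sup>2)"
      \<comment> \<open>\<open>orthonormal_comb_norm\<close> concerns conjugated frame vectors, so
        it is applied to the conjugate frame.\<close>
      using orthonormal_comb_norm[OF orthonormal_cnj[OF on], of c] by (simp add: a_def)
    also have "\<dots> \<le> (\<Sum>l<n'. (cmod (b l))\<^sup>2 * (2 / (real d * real e)))"
    proof (rule sum_mono)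
      fix l assume "l \<in> {..<n'}"
      hence l: "l < n'" by simp
      have "(cmod (c l))\<^sup>2 = (cmod (b l))\<^sup>2 * (1 / \<mu> (h l))"
        using hpos[OF l] by (simp add: c_def norm_divide power_divide)
      also have "1 / \<mu> (h l) \<le> 1 / (real d * real e / 2)"
        using hn(2)[OF l] de by (intro divide_left_mono) auto
      finally show "(cmod (c l))\<^sup>2 \<le> (cmod (b l))\<^sup>2 * (2 / (real d * real e))"
        by (simp add: mult_left_mono)
    qed
    also have "\<dots> = 2 / (real d * real e)" unfolding sum_distrib_right[symmetric] b by simp
    finally have a: "(\<Sum>j<n. (cmod (a j))\<^sup>2) \<le> 2 / (real d * real e)" .
    have appa: "app a i \<kappa> = (\<Sum>l<n'. V i \<kappa> l * b l)" for i \<kappa>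
    proof -
      have "app a i \<kappa> = (\<Sum>j<n. \<Sum>l<n'. of_real (G (i,\<kappa>,j)) * u (h l) j * c l)"
        by (simp add: app_def a_def sum_distrib_left mult_ac)
      also have "\<dots> = (\<Sum>l<n'. app (u (h l)) i \<kappa> * c l)"
        by (subst sum.swap) (simp add: app_def sum_distrib_right)
      finally show ?thesis by (simp add: V_def c_def)
    qed
    have "(\<Sum>l<k. \<Sum>\<kappa><e. (cmod (\<Sum>i<d. cnj (q l i) * (\<Sum>j<n'. V i \<kappa> j * b j)))\<^sup>2) = frame_energy d n e k G q a"
      by (simp only: frame_energy_def app_def[symmetric] appa)
    also have "\<dots> \<le> 3 * (real k * real e) * (\<Sum>j<n. (cmod (a j))\<^sup>2)" by (rule frame_energy_le[OF q])
    also have "\<dots> \<le> 3 * (real k * real e) * (2 / (real d * real e))" using a by (intro mult_left_mono) auto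
    also have "\<dots> = 6 * real k / real d" using pos by (simp add: field_simps)
    finally show "(\<Sum>l<k. \<Sum>\<kappa><e. (cmod (\<Sum>i<d. cnj (q l i) * (\<Sum>j<n'. V i \<kappa> j * b j)))\<^sup>2) \<le> 6 * real k / real d" .
  qed
  ultimately show ?thesis by blast
qed

end

section \<open>Entropies and norms\<close>

lemma unit_vecs_nonempty:
  assumes "0 < n" shows "unit_vecs n \<noteq> {}"
proof -
  have "(\<Sum>i<n. (cmod (vec_index (unit_vec n 0) i))\<^sup>2) = (\<Sum>i<n. if i = 0 then 1 else 0)"
    by (intro sum.cong) auto
  hence "unit_vec n 0 \<in> unit_vecs n" using assms by (simp add: unit_vecs_def)
  thus ?thesis by blast
qed

text \<open>For \<open>p > 1\<close> the factor \<open>1 / (1 - p)\<close> is negative, so an upper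
  bound on the trace power is a lower bound on the entropy. Writing the bound as
  \<open>exp ((1 - p) * b)\<close> lets one estimate serve both entropies and norms.\<close>

lemma renyi_entropy_ge:
  assumes "1 < p" "0 < trace_power \<sigma> p" "trace_power \<sigma> p \<le> exp ((1 - p) * b)"
  shows "b \<le> renyi_entropy p \<sigma>"
proof -
  have "ln (trace_power \<sigma> p) \<le> (1 - p) * b" using assms by (metis ln_exp ln_le_cancel_iff exp_gt_zero)
  thus ?thesis using assms(1) by (simp add: renyi_entropy_def neg_le_divide_eq mult.commute)
qed

lemma renyi_entropy_le:
  assumes "1 < p" "exp ((1 - p) * b) \<le> trace_power \<sigma> p"
  shows "renyi_entropy p \<sigma> \<le> b"
proof -
  have "0 < trace_power \<sigma> p" using assms(2) exp_gt_zero[of "(1 - p) * b"] by linarith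
  hence "(1 - p) * b \<le> ln (trace_power \<sigma> p)" using assms(2) by (simp add: ln_ge_iff)
  thus ?thesis using assms(1) by (simp add: renyi_entropy_def neg_divide_le_eq mult.commute)
qed

lemma min_output_renyi_kraus_ge:
  assumes V: "isometry d n e V" and n: "0 < n" and p: "1 < p"
    and tp: "\<And>\<rho>. density_op n \<rho> \<Longrightarrow> trace_power (kraus d n e V \<rho>) p \<le> exp ((1 - p) * b)"
  shows "b \<le> min_output_renyi p n (kraus d n e V)"
  unfolding min_output_renyi_def
proof (rule cINF_greatest[OF unit_vecs_nonempty[OF n]])
  fix v assume "v \<in> unit_vecs n"
  hence \<rho>: "density_op n (pure_state n v)" by (rule density_pure_state)
  show "b \<le> renyi_entropy p (kraus d n e V (pure_state n v))"
    by (rule renyi_entropy_ge[OF p trace_power_density_pos[OF density_kraus[OF V \<rho>]] tp[OF \<rho>]])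
qed

lemma min_output_renyi_kraus_le:
  assumes V: "isometry d n e V" and p: "1 < p" and v: "v \<in> unit_vecs n"
    and tp: "exp ((1 - p) * b) \<le> trace_power (kraus d n e V (pure_state n v)) p"
  shows "min_output_renyi p n (kraus d n e V) \<le> b"
  unfolding min_output_renyi_def
proof (rule cINF_lower2[OF _ v])
  show "renyi_entropy p (kraus d n e V (pure_state n v)) \<le> b" by (rule renyi_entropy_le[OF p tp])
  show "bdd_below ((\<lambda>v. renyi_entropy p (kraus d n e V (pure_state n v))) ` unit_vecs n)"
  proof (rule bdd_belowI2)
    fix v assume "v \<in> unit_vecs n"
    hence "density_op d (kraus d n e V (pure_state n v))" by (intro density_kraus[OF V] density_pure_state)
    thus "0 \<le> renyi_entropy p (kraus d n e V (pure_state n v))"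
      using p by (intro renyi_entropy_ge) (auto intro: trace_power_density_pos trace_power_density_le_1)
  qed
qed

lemma max_output_pnorm_kraus_le:
  assumes V: "isometry d n e V" and n: "0 < n" and p: "1 < p"
    and tp: "\<And>\<rho>. density_op n \<rho> \<Longrightarrow> trace_power (kraus d n e V \<rho>) p \<le> exp ((1 - p) * b)"
  shows "max_output_pnorm p n (kraus d n e V) \<le> exp ((1 - p) * b / p)"
  unfolding max_output_pnorm_def
proof (rule cSUP_least)
  show "{\<rho>. density_op n \<rho>} \<noteq> {}" using unit_vecs_nonempty[OF n] density_pure_state by blast
  fix \<rho> assume "\<rho> \<in> {\<rho>. density_op n \<rho>}"
  hence \<rho>: "density_op n \<rho>" by simp
  have "schatten_norm_psd p (kraus d n e V \<rho>) \<le> exp ((1 - p) * b) powr (1 / p)"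
    unfolding schatten_norm_psd_def using p
    by (intro powr_mono2 tp[OF \<rho>] less_imp_le[OF trace_power_density_pos[OF density_kraus[OF V \<rho>]]]) auto
  thus "schatten_norm_psd p (kraus d n e V \<rho>) \<le> exp ((1 - p) * b / p)" by (simp add: powr_def)
qed

lemma max_output_pnorm_kraus_ge:
  assumes V: "isometry d n e V" and p: "1 < p" and \<rho>: "density_op n \<rho>"
    and tp: "exp ((1 - p) * b) \<le> trace_power (kraus d n e V \<rho>) p"
  shows "exp ((1 - p) * b / p) \<le> max_output_pnorm p n (kraus d n e V)"
  unfolding max_output_pnorm_def
proof (rule cSUP_upper2[where x = \<rho>])
  show "bdd_above ((\<lambda>\<rho>. schatten_norm_psd p (kraus d n e V \<rho>)) ` {\<rho>. density_op n \<rho>})"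
  proof (rule bdd_aboveI2)
    fix \<rho> assume "\<rho> \<in> {\<rho>. density_op n \<rho>}"
    hence D: "density_op d (kraus d n e V \<rho>)" using density_kraus[OF V] by simp
    have "schatten_norm_psd p (kraus d n e V \<rho>) \<le> 1 powr (1 / p)"
      unfolding schatten_norm_psd_def using p
      by (intro powr_mono2 trace_power_density_le_1[OF D] less_imp_le[OF trace_power_density_pos[OF D]]) auto
    thus "schatten_norm_psd p (kraus d n e V \<rho>) \<le> 1" by simp
  qed
  have "exp ((1 - p) * b) powr (1 / p) \<le> schatten_norm_psd p (kraus d n e V \<rho>)"
    unfolding schatten_norm_psd_def using p tp by (intro powr_mono2) auto
  thus "exp ((1 - p) * b / p) \<le> schatten_norm_psd p (kraus d n e V \<rho>)" by (simp add: powr_def)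
qed (use \<rho> in simp)

text \<open>\<open>B\<close> turns the frame bound into a trace power of at most
  \<open>(exp 2 / d) powr (p - 1)\<close>, that is, entropy at least \<open>ln d - 2\<close>. By
  \<open>t\<close> the maximally entangled input yields an eigenvalue of at least
  \<open>d powr (1 - p) / 12\<close>, and \<open>C\<close> is the constant for which its
  \<open>p\<close>-th power equals \<open>exp ((1 - p) * (p * ln d + C))\<close>. \<open>big\<close>
  makes the gap positive; the norm inequality uses the same trace bounds.\<close>

lemma nonadditivity_of_frame_bound:
  fixes p :: real and V :: "nat \<Rightarrow> nat \<Rightarrow> nat \<Rightarrow> complex"
  defines "C \<equiv> p * ln 12 / (p - 1)"
    and "W \<equiv> \<lambda>i \<kappa> j. cnj (V i \<kappa> j)"
  assumes p: "1 < p" "p < 2" and pos: "0 < n" "0 < d" "0 < e" "0 < k" "k \<le> d"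
    and V: "isometry d n e V" "frame_bound d n e V k (6 * real k / real d)"
    and B: "(6 / real d) powr (p - 1) + (6 * real k / real d) powr p \<le> (exp 2 / d) powr (p - 1)"
    and t: "real d powr (1 - p) / 12 \<le> real n / (real d * real e)"
    and big: "C + 4 < (2 - p) * ln d"
  defines "N1 \<equiv> kraus d n e V" and "N2 \<equiv> kraus d n e W"
  shows "quantum_channel n d N1 \<and> quantum_channel n d N2 \<and>
    min_output_renyi p n N1 \<ge> ln (real d) - 2 \<and>
    min_output_renyi p n N2 \<ge> ln (real d) - 2 \<and>
    min_output_renyi p (n*n) (tensor_channel n d n d N1 N2) \<le> p * ln (real d) + C \<and>
    min_output_renyi p n N1 + min_output_renyi p n N2
      - min_output_renyi p (n*n) (tensor_channel n d n d N1 N2)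
      \<ge> (2 - p) * ln (real d) - C - 4 \<and>
    min_output_renyi p n N1 + min_output_renyi p n N2
      - min_output_renyi p (n*n) (tensor_channel n d n d N1 N2) > 0 \<and>
    max_output_pnorm p (n*n) (tensor_channel n d n d N1 N2)
      > max_output_pnorm p n N1 * max_output_pnorm p n N2"
proof -
  have W: "isometry d n e W" "frame_bound d n e W k (6 * real k / real d)"
    unfolding W_def using V by (auto intro: isometry_cnj frame_bound_cnj)
  have d: "0 < real d" using pos by simp
  have tp: "trace_power (kraus d n e U \<rho>) p \<le> exp ((1 - p) * (ln d - 2))"
    if U: "isometry d n e U" "frame_bound d n e U k (6 * real k / real d)" and \<rho>: "density_op n \<rho>" for U \<rho>
  proof -
    have "trace_power (kraus d n e U \<rho>) p \<le> (6 / real d) powr (p - 1) + (6 * real k / real d) powr p"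
      by (rule trace_power_le_of_frames[OF density_kraus[OF U(1) \<rho>] p(1) pos(4,5) _ frame_bound_density[OF U(2) \<rho>]]) auto
    also have "\<dots> \<le> exp ((1 - p) * (ln d - 2))"
      using B d by (simp add: powr_def ln_div algebra_simps)
    finally show ?thesis .
  qed
  let ?T = "tensor_kraus d e n V W"
  have T: "tensor_channel n d n d N1 N2 = kraus (d*d) (n*n) (e*e) ?T"
    unfolding N1_def N2_def by (rule ext) (rule tensor_channel_kraus)
  have IT: "isometry (d*d) (n*n) (e*e) ?T" by (rule isometry_tensor[OF V(1) W(1)])
  let ?\<Omega> = "pure_state (n*n) (max_entangled n)"
  have \<Omega>: "density_op (n*n) ?\<Omega>" by (intro density_pure_state max_entangled_unit pos)
  have tpT: "exp ((1 - p) * (p * ln d + C)) \<le> trace_power (kraus (d*d) (n*n) (e*e) ?T ?\<Omega>) p"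
  proof -
    have "exp ((1 - p) * (p * ln d + C)) = (real d powr (1 - p) / 12) powr p"
    proof -
      have "(1 - p) * (p * ln d + C) = p * ((1 - p) * ln d - ln 12)"
        using p by (simp add: C_def field_simps)
      thus ?thesis using d by (simp add: powr_def ln_div)
    qed
    also have "\<dots> \<le> trace_power (kraus (d*d) (n*n) (e*e) ?T ?\<Omega>) p"
    proof (rule trace_power_ge_qform[OF density_kraus[OF IT \<Omega>] max_entangled_norm])
      show "real d powr (1 - p) / 12 \<le> Re (qform (d*d) (kraus (d*d) (n*n) (e*e) ?T ?\<Omega>) (vec_index (max_entangled d)))"
        using order_trans[OF t max_entangled_overlap[OF V(1) pos(1-3)]] unfolding W_def .
    qed (use p pos in auto)
    finally show ?thesis .
  qed
  have m1: "ln d - 2 \<le> min_output_renyi p n N1" unfolding N1_def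
    by (intro min_output_renyi_kraus_ge V p pos tp)
  have m2: "ln d - 2 \<le> min_output_renyi p n N2" unfolding N2_def
    by (intro min_output_renyi_kraus_ge W p pos tp)
  have m3: "min_output_renyi p (n*n) (tensor_channel n d n d N1 N2) \<le> p * ln d + C" unfolding T
    by (rule min_output_renyi_kraus_le[OF IT p(1) max_entangled_unit[OF pos(1)] tpT])
  have x1: "max_output_pnorm p n N1 \<le> exp ((1 - p) * (ln d - 2) / p)" unfolding N1_def
    by (intro max_output_pnorm_kraus_le V p pos tp)
  have x2: "max_output_pnorm p n N2 \<le> exp ((1 - p) * (ln d - 2) / p)" unfolding N2_def
    by (intro max_output_pnorm_kraus_le W p pos tp)
  have x0: "0 \<le> max_output_pnorm p n N2"
  proof -
    obtain v where "v \<in> unit_vecs n" using unit_vecs_nonempty[OF pos(1)] by blast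
    hence \<rho>: "density_op n (pure_state n v)" by (rule density_pure_state)
    \<comment> \<open>Chosen so that \<open>exp ((1 - p) * b)\<close> is the trace power itself; the
      lower bound on the norm is then an exponential, hence nonnegative.\<close>
    define b where "b = ln (trace_power (kraus d n e W (pure_state n v)) p) / (1 - p)"
    have "exp ((1 - p) * b) \<le> trace_power (kraus d n e W (pure_state n v)) p"
      using p trace_power_density_pos[OF density_kraus[OF W(1) \<rho>]] by (simp add: b_def)
    from max_output_pnorm_kraus_ge[OF W(1) p(1) \<rho> this] show ?thesis
      unfolding N2_def using exp_ge_zero order_trans by blast
  qed
  have "max_output_pnorm p n N1 * max_output_pnorm p n N2 \<le> exp ((1 - p) * (ln d - 2) / p) * exp ((1 - p) * (ln d - 2) / p)"
    by (rule mult_mono[OF x1 x2 _ x0]) simp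
  also have "\<dots> < exp ((1 - p) * (p * ln d + C) / p)"
  proof -
    \<comment> \<open>The condition \<open>big\<close> rearranged; multiplying by the negative
      \<open>1 - p\<close> reverses it into the comparison of norms.\<close>
    have "p * ln d + C < 2 * (ln d - 2)" using big by (simp add: algebra_simps)
    hence "(1 - p) * (2 * (ln d - 2)) / p < (1 - p) * (p * ln d + C) / p"
      using p by (intro divide_strict_right_mono mult_strict_left_mono_neg) auto
    thus ?thesis by (simp add: algebra_simps flip: exp_add add_divide_distrib)
  qed
  also have "\<dots> \<le> max_output_pnorm p (n*n) (tensor_channel n d n d N1 N2)" unfolding T
    by (rule max_output_pnorm_kraus_ge[OF IT p(1) \<Omega> tpT])
  finally have x: "max_output_pnorm p n N1 * max_output_pnorm p n N2 < max_output_pnorm p (n*n) (tensor_channel n d n d N1 N2)" .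
  have "quantum_channel n d N1" "quantum_channel n d N2"
    unfolding N1_def N2_def using V W pos by (auto intro: quantum_channel_kraus)
  moreover have "(2 - p) * ln d - C - 4 \<le> min_output_renyi p n N1 + min_output_renyi p n N2
      - min_output_renyi p (n*n) (tensor_channel n d n d N1 N2)"
    using m1 m2 m3 by (simp add: algebra_simps)
  moreover from this have "0 < min_output_renyi p n N1 + min_output_renyi p n N2
      - min_output_renyi p (n*n) (tensor_channel n d n d N1 N2)" using big by linarith
  ultimately show ?thesis using m1 m2 m3 x by blast
qed

section \<open>Choice of the dimensions and conclusion\<close>

text \<open>\<open>s\<close> is the midpoint of the interval from \<open>2 - p\<close> to
  \<open>1 / p\<close>, which is nonempty because \<open>(p - 1)^2 > 0\<close>. The first two
  conditions feed the union bound, the third gives \<open>k \<le> d\<close>, the fourth the entropy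
  bound, the fifth the positive gap.\<close>

lemma eventually_parameters:
  fixes p :: real
  assumes p: "1 < p" "p < 2"
  obtains s :: real where
    "\<forall>\<^sub>F x in at_top. 160 * x powr (2 - p) * ln (160 * x ^ 8 + 1) \<le> x powr s"
    "\<forall>\<^sub>F x in at_top. 160 * ln (160 * x ^ 8 + 1) \<le> (x::real)"
    "\<forall>\<^sub>F x in at_top. x powr s + 1 \<le> (x::real)"
    "\<forall>\<^sub>F x in at_top. (6 / x) powr (p - 1) + (6 * (x powr s + 1) / x) powr p \<le> (exp 2 / x) powr (p - 1)"
    "\<forall>\<^sub>F x in at_top. p * ln 12 / (p - 1) + 4 < (2 - p) * ln x"
proof -
  define s where "s = (2 - p + 1 / p) / 2"
  have "(p - 1) * (p - 1) > 0" using p by simp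
  hence "2 - p < 1 / p" using p by (simp add: field_simps)
  hence s: "2 - p < s" "s < 1 / p" "0 < s" using p by (auto simp: s_def)
  hence ps: "p * s < 1" using p by (simp add: field_simps)
  have "1 / p < 1" using p by simp
  hence s1: "s < 1" using s by linarith
  show ?thesis
  proof (rule that[of s])
    have "\<forall>\<^sub>F x in at_top. 160 * ln (160 * x ^ 8 + 1) \<le> x powr (s - (2 - p))"
      using s by real_asymp
    moreover have "\<forall>\<^sub>F x in at_top. (0::real) < x" by (rule eventually_gt_at_top)
    ultimately show "\<forall>\<^sub>F x in at_top. 160 * x powr (2 - p) * ln (160 * x ^ 8 + 1) \<le> x powr s"
    proof eventually_elim
      case (elim x)
      have "x powr (2 - p) * (160 * ln (160 * x ^ 8 + 1)) \<le> x powr (2 - p) * x powr (s - (2 - p))"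
        using elim by (intro mult_left_mono) auto
      also have "\<dots> = x powr s" by (simp flip: powr_add)
      finally show ?case by (simp add: mult_ac)
    qed
    show "\<forall>\<^sub>F x in at_top. 160 * ln (160 * x ^ 8 + 1) \<le> (x::real)" by real_asymp
    show "\<forall>\<^sub>F x in at_top. x powr s + 1 \<le> (x::real)" using s s1 by real_asymp
    show "\<forall>\<^sub>F x in at_top. p * ln 12 / (p - 1) + 4 < (2 - p) * ln x" using p by real_asymp
    \<comment> \<open>The slack between \<open>exp 2\<close> and 6, which leaves room for the term
      with \<open>k\<close>. It is positive because \<open>e > 5/2\<close> and
      \<open>(5/2)^2 > 6\<close>.\<close>
    define c where "c = exp 2 powr (p - 1) - 6 powr (p - 1)"
    have e2: "(6::real) < exp 2"
    proof -
      have "(5/2::real) < exp 1" using e_approx_32 by (simp add: abs_if split: if_splits)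
      hence "(5/2::real) * (5/2) < exp 1 * exp 1" by (intro mult_strict_mono) auto
      thus ?thesis by (simp flip: exp_add)
    qed
    have c: "0 < c" unfolding c_def using powr_less_mono2[of "p - 1" 6 "exp 2"] e2 p by simp
    have "((\<lambda>x::real. 12 powr p * x powr (p * s - 1)) \<longlongrightarrow> 0) at_top" using ps by real_asymp
    hence "\<forall>\<^sub>F x in at_top. 12 powr p * x powr (p * s - 1) < c" using c by (rule order_tendstoD(2))
    moreover have "\<forall>\<^sub>F x in at_top. (1::real) \<le> x" by (rule eventually_ge_at_top)
    ultimately show "\<forall>\<^sub>F x in at_top. (6 / x) powr (p - 1) + (6 * (x powr s + 1) / x) powr p \<le> (exp 2 / x) powr (p - 1)"
    proof eventually_elim
      case (elim x)
      \<comment> \<open>Lets \<open>x powr s + 1\<close> be replaced by \<open>2 * x powr s\<close>,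
        whence the 12. The term is then of order \<open>x powr (p * s - 1)\<close> relative to
        \<open>x powr (1 - p)\<close>, negligible because \<open>p * s < 1\<close>.\<close>
      have "1 \<le> x powr s" using elim s by (simp add: ge_one_powr_ge_zero)
      hence "(6 * (x powr s + 1) / x) powr p \<le> (12 * x powr (s - 1)) powr p"
        using elim p by (intro powr_mono2) (auto simp: powr_diff field_simps)
      also have "\<dots> = (12 powr p * x powr (p * s - 1)) * x powr (1 - p)"
        using elim by (simp add: powr_mult powr_powr algebra_simps flip: powr_add)
      also have "\<dots> \<le> c * x powr (1 - p)" using elim by (intro mult_right_mono) auto
      also have "\<dots> = (exp 2 / x) powr (p - 1) - (6 / x) powr (p - 1)"
        using elim by (simp add: c_def powr_divide powr_diff field_simps)
      finally show ?case by simp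
    qed
  qed
qed

theorem theorem1:
  fixes p :: real
  assumes "1 < p" and "p < 2"
  shows "\<exists>C::real. \<exists>D::nat. \<forall>d\<ge>D. \<exists>n1 n2 N1 N2.
    quantum_channel n1 d N1 \<and> quantum_channel n2 d N2 \<and>
    min_output_renyi p n1 N1 \<ge> ln (real d) - 2 \<and>
    min_output_renyi p n2 N2 \<ge> ln (real d) - 2 \<and>
    min_output_renyi p (n1*n2) (tensor_channel n1 d n2 d N1 N2) \<le> p * ln (real d) + C \<and>
    min_output_renyi p n1 N1 + min_output_renyi p n2 N2
      - min_output_renyi p (n1*n2) (tensor_channel n1 d n2 d N1 N2)
      \<ge> (2 - p) * ln (real d) - C - 4 \<and>
    min_output_renyi p n1 N1 + min_output_renyi p n2 N2
      - min_output_renyi p (n1*n2) (tensor_channel n1 d n2 d N1 N2) > 0 \<and>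
    max_output_pnorm p (n1*n2) (tensor_channel n1 d n2 d N1 N2)
      > max_output_pnorm p n1 N1 * max_output_pnorm p n2 N2"
proof -
  define C where "C = p * ln 12 / (p - 1)"
  obtain s :: real where ev:
    "\<forall>\<^sub>F x in at_top. 160 * x powr (2 - p) * ln (160 * x ^ 8 + 1) \<le> x powr s"
    "\<forall>\<^sub>F x in at_top. 160 * ln (160 * x ^ 8 + 1) \<le> (x::real)"
    "\<forall>\<^sub>F x in at_top. x powr s + 1 \<le> (x::real)"
    "\<forall>\<^sub>F x in at_top. (6 / x) powr (p - 1) + (6 * (x powr s + 1) / x) powr p \<le> (exp 2 / x) powr (p - 1)"
    "\<forall>\<^sub>F x in at_top. p * ln 12 / (p - 1) + 4 < (2 - p) * ln x"
    using eventually_parameters[OF assms] by blast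
  let ?P = "\<lambda>x::real. 160 * x powr (2 - p) * ln (160 * x ^ 8 + 1) \<le> x powr s \<and>
    160 * ln (160 * x ^ 8 + 1) \<le> x \<and> x powr s + 1 \<le> x \<and>
    (6 / x) powr (p - 1) + (6 * (x powr s + 1) / x) powr p \<le> (exp 2 / x) powr (p - 1) \<and>
    C + 4 < (2 - p) * ln x \<and> 1 \<le> x"
  have "\<forall>\<^sub>F x in at_top. ?P x" unfolding C_def by (intro eventually_conj ev eventually_ge_at_top)
  hence "\<forall>\<^sub>F d in sequentially. ?P (real d)" by (rule eventually_compose_filterlim[OF _ filterlim_real_sequentially])
  then obtain D where D: "\<And>d. d \<ge> D \<Longrightarrow> ?P (real d)" unfolding eventually_sequentially by blast
  have "\<exists>n N1 N2. quantum_channel n d N1 \<and> quantum_channel n d N2 \<and>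
    min_output_renyi p n N1 \<ge> ln (real d) - 2 \<and>
    min_output_renyi p n N2 \<ge> ln (real d) - 2 \<and>
    min_output_renyi p (n*n) (tensor_channel n d n d N1 N2) \<le> p * ln (real d) + C \<and>
    min_output_renyi p n N1 + min_output_renyi p n N2
      - min_output_renyi p (n*n) (tensor_channel n d n d N1 N2)
      \<ge> (2 - p) * ln (real d) - C - 4 \<and>
    min_output_renyi p n N1 + min_output_renyi p n N2
      - min_output_renyi p (n*n) (tensor_channel n d n d N1 N2) > 0 \<and>
    max_output_pnorm p (n*n) (tensor_channel n d n d N1 N2)
      > max_output_pnorm p n N1 * max_output_pnorm p n N2" if "d \<ge> D" for d
  proof -
    define x where "x = real d"
    have P: "160 * x powr (2 - p) * ln (160 * x ^ 8 + 1) \<le> x powr s"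
      "160 * ln (160 * x ^ 8 + 1) \<le> x" "x powr s + 1 \<le> x"
      "(6 / x) powr (p - 1) + (6 * (x powr s + 1) / x) powr p \<le> (exp 2 / x) powr (p - 1)"
      "C + 4 < (2 - p) * ln x" "1 \<le> x" using D[OF that] by (auto simp: x_def)
    \<comment> \<open>Rounding down loses at most a factor 2, as the power is at least 1. With
      \<open>n = d^2 * m\<close> and \<open>e = d^2\<close>, the ratio \<open>n / e\<close> is the
      integer \<open>m\<close>.\<close>
    define m where "m = nat \<lfloor>x powr (2 - p)\<rfloor>"
    define n where "n = d\<^sup>2 * m"
    define e where "e = d\<^sup>2"
    define k where "k = nat \<lceil>x powr s\<rceil>"
    have d: "0 < d" using P(6) by (simp add: x_def)
    have xp: "1 \<le> x powr (2 - p)" using P(6) assms by (simp add: ge_one_powr_ge_zero)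
    have fl: "real m = of_int \<lfloor>x powr (2 - p)\<rfloor>" "1 \<le> \<lfloor>x powr (2 - p)\<rfloor>" using xp by (auto simp: m_def)
    have m: "real m \<le> x powr (2 - p)" "x powr (2 - p) / 2 \<le> real m" "0 < m"
      using fl by linarith+
    have k: "x powr s \<le> real k" "real k \<le> x powr s + 1" "0 < k"
      using P(6) unfolding k_def by (linarith | simp add: le_nat_iff)+
    have kd: "k \<le> d" using k(2) P(3) by (simp add: x_def)
    have mx: "real m \<le> x"
    proof -
      have "x powr (2 - p) \<le> x powr 1" using P(6) assms by (intro powr_mono) auto
      thus ?thesis using m(1) P(6) by simp
    qed
    have n: "0 < n" "real n = x\<^sup>2 * real m" using d m by (auto simp: n_def x_def)
    have e: "0 < e" "real e = x\<^sup>2" using d by (auto simp: e_def x_def)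
    have H: "8 * (real n + real k * real d) * ln (160 * (real d * real n)\<^sup>2 + 1) \<le> real k * real e / 10"
    proof -
      define L where "L = ln (160 * x ^ 8 + 1)"
      \<comment> \<open>\<open>m \<le> x\<close> gives \<open>n \<le> x^3\<close>; this is the
        origin of the eighth power in the logarithm.\<close>
      have "real d * real n \<le> x * (x\<^sup>2 * x)" unfolding n x_def[symmetric] using mx P(6) by (intro mult_left_mono) auto
      hence "(real d * real n)\<^sup>2 \<le> (x * (x\<^sup>2 * x))\<^sup>2" by (intro power_mono) auto
      also have "\<dots> = x ^ 8" by (simp add: power2_eq_square eval_nat_numeral)
      finally have "ln (160 * (real d * real n)\<^sup>2 + 1) \<le> L" unfolding L_def by (subst ln_le_cancel_iff) (auto intro: add_nonneg_pos)
      hence "8 * (real n + real k * real d) * ln (160 * (real d * real n)\<^sup>2 + 1) \<le> 8 * (real n + real k * real d) * L"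
        by (intro mult_left_mono) auto
      also have "\<dots> = x\<^sup>2 * (8 * real m * L) + x * real k * (8 * L)"
        by (simp add: n x_def[symmetric] algebra_simps)
      \<comment> \<open>The net of inputs and the net of frames may each use half of the allowance:
        the exponent \<open>s > 2 - p\<close> pays for the inputs, \<open>e = d^2\<close> for the
        frames.\<close>
      also have "\<dots> \<le> x\<^sup>2 * (real k / 20) + x * real k * (x / 20)"
      proof (intro add_mono mult_left_mono)
        have L0: "0 \<le> L" unfolding L_def using P(6) by simp
        have "160 * real m * L \<le> 160 * x powr (2 - p) * L" using m L0 by (intro mult_right_mono) auto
        also have "\<dots> \<le> x powr s" using P(1) by (simp add: L_def)
        finally show "8 * real m * L \<le> real k / 20" using k(1) by simp
        show "8 * L \<le> x / 20" using P(2) by (simp add: L_def)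
      qed (use P(6) in auto)
      also have "\<dots> = real k * real e / 10" by (simp add: e power2_eq_square)
      finally show ?thesis .
    qed
    obtain G where G: "G \<in> sign_tensors d n e"
      "\<And>a q. (\<Sum>j<n. (cmod (a j))\<^sup>2) = 1 \<Longrightarrow> orthonormal k d q \<Longrightarrow> frame_energy d n e k G q a \<le> 3 * (real k * real e)"
      using exists_sign_tensor[OF n(1) d H] by blast
    obtain n' V where nV: "n \<le> 6 * n'" "isometry d n' e V" "frame_bound d n' e V k (6 * real k / real d)"
      using isometry_of_sign_tensor[OF d n(1) e(1) k(3) kd G] by blast
    have n': "0 < n'" using nV(1) n(1) by simp
    have B: "(6 / real d) powr (p - 1) + (6 * real k / real d) powr p \<le> (exp 2 / d) powr (p - 1)"
    proof -
      have "(6 * real k / x) powr p \<le> (6 * (x powr s + 1) / x) powr p"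
        using k(2) P(6) assms by (intro powr_mono2 divide_right_mono) auto
      thus ?thesis using P(4) by (simp add: x_def)
    qed
    \<comment> \<open>The 12 is 2 from rounding \<open>m\<close> down times 6 from the discarded
      eigenvectors.\<close>
    have t: "real d powr (1 - p) / 12 \<le> real n' / (real d * real e)"
    proof -
      have "real n \<le> 6 * real n'" using nV(1) by linarith
      hence "x\<^sup>2 * (x powr (2 - p) / 2) \<le> 6 * real n'"
        using m(2) n(2) mult_left_mono[OF m(2), of "x\<^sup>2"] by simp
      hence "x\<^sup>2 * (x powr (2 - p) / 2) / (6 * x * x\<^sup>2) \<le> 6 * real n' / (6 * x * x\<^sup>2)"
        using P(6) by (intro divide_right_mono) auto
      also have "x\<^sup>2 * (x powr (2 - p) / 2) / (6 * x * x\<^sup>2) = x powr (2 - p) / x / 12"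
        using P(6) by (simp add: field_simps)
      also have "x powr (2 - p) / x = x powr (1 - p)"
        using P(6) powr_diff[of x "2 - p" 1] by simp
      also have "6 * real n' / (6 * x * x\<^sup>2) = real n' / (real d * real e)"
        by (simp add: e x_def[symmetric])
      finally show ?thesis by (simp only: x_def)
    qed
    show ?thesis
      using nonadditivity_of_frame_bound[OF assms n' d e(1) k(3) kd nV(2,3) B t] P(5)
      unfolding C_def x_def by blast
  qed
  thus ?thesis by blast
qed

end
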